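(* Let $R,S\in\mathscr{A}$ be two symmetries with $\tau(R)=\alpha$, $\tau(S)=\beta$, let $(U_t)_{t\ge0}$ be a free unitary Brownian motion freely independent from $\{R,S\}$, and let $\nu_\infty$ be the weak limit, as $t\to\infty$, of the spectral distribution $\nu_t$ of $RU_tSU_t^*$. Then, identifying $\mathbb{T}$ with $(-\pi,\pi]$ via $\theta\mapsto e^{i\theta}$, $$\nu_\infty=a\,\delta_\pi+b\,\delta_0+\frac{\sqrt{-(\cos\theta-r_+)(\cos\theta-r_-)}}{2\pi|\sin\theta|}\,\mathbf 1_{(\theta_+,\theta_-)\cup(-\theta_-,-\theta_+)}(\theta)\,d\theta,$$ where $$a=\frac{|\alpha-\beta|}{2},\quad b=\frac{|\alpha+\beta|}{2},\quad r_\pm=-\alpha\beta\pm\sqrt{(1-\alpha^2)(1-\beta^2)},\quad \theta_\pm=\arccos r_\pm .$$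
   Context: $(\mathscr{A},\tau)$ is a $W^*$-probability space; a symmetry is a self-adjoint unitary. $(U_t)_{t\ge0}$, $U_0=\mathbf 1$, solves $dU_t=iU_t\,dB_t-\tfrac12U_t\,dt$ with $(B_t)$ a free additive (semicircular) Brownian motion, $\tau(B_t^2)=t$. The limit $\nu_\infty$ exists and equals the free multiplicative convolution of the spectral distributions of $R$ and $S$; its Herglotz transform $\int_{\mathbb T}\frac{\zeta+z}{\zeta-z}d\nu_\infty(\zeta)$ is $H(\infty,z)=\sqrt{1+4z\frac{\alpha\beta(1+z)^2+(\alpha-\beta)^2z}{(1-z^2)^2}}$ (principal branch). $\delta_\pi,\delta_0$ are the Dirac masses at angles $\pi$ and $0$ (the points $-1$ and $1$), and $d\theta$ is unnormalized Lebesgue measure on $(-\pi,\pi]$. *)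

theory Defs
  imports "HOL-Probability.Probability" "HOL.Hull"
begin

section \<open>W*-probability spaces\<close>

text \<open>
  Elements of a unital C*-algebra form a type. The real Banach algebra structure is that of the
  library; the complex scalar multiplication \<open>scaleC\<close> extends \<open>scaleR\<close>.
\<close>

class cstar_algebra = banach + real_normed_algebra_1 +
  fixes scaleC :: "complex \<Rightarrow> 'a \<Rightarrow> 'a" (infixr "*\<^sub>C" 75)
    and star :: "'a \<Rightarrow> 'a"
  assumes scaleC_of_real: "complex_of_real r *\<^sub>C x = r *\<^sub>R x"
    and scaleC_add_left: "(c + d) *\<^sub>C x = c *\<^sub>C x + d *\<^sub>C x"
    and scaleC_add_right: "c *\<^sub>C (x + y) = c *\<^sub>C x + c *\<^sub>C y"
    and scaleC_scaleC: "c *\<^sub>C (d *\<^sub>C x) = (c * d) *\<^sub>C x"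
    and norm_scaleC: "norm (c *\<^sub>C x) = cmod c * norm x"
    and mult_scaleC_left: "(c *\<^sub>C x) * y = c *\<^sub>C (x * y)"
    and mult_scaleC_right: "x * (c *\<^sub>C y) = c *\<^sub>C (x * y)"
    and star_star: "star (star x) = x"
    and star_add: "star (x + y) = star x + star y"
    and star_scaleC: "star (c *\<^sub>C x) = cnj c *\<^sub>C star x"
    and star_mult: "star (x * y) = star y * star x"
    and cstar_identity: "norm (star x * x) = (norm x)\<^sup>2"

definition dual_space :: "('a::cstar_algebra \<Rightarrow> complex) set" where
  "dual_space = {\<phi>. bounded_linear \<phi> \<and> (\<forall>c x. \<phi> (c *\<^sub>C x) = c * \<phi> x)}"

text \<open>
  A predual in the sense of Sakai, realised inside the dual: a norm-closed complex subspace \<open>P\<close>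
  of the dual such that \<open>x \<mapsto> (\<phi> \<mapsto> \<phi> x)\<close> is an isometry of the algebra onto the Banach space dual
  of \<open>P\<close>. The elements of \<open>P\<close> are the normal functionals.
\<close>

definition predual :: "('a::cstar_algebra \<Rightarrow> complex) set \<Rightarrow> bool" where
  "predual P \<longleftrightarrow>
     P \<subseteq> dual_space \<and> (\<lambda>x. 0) \<in> P \<and>
     (\<forall>\<phi>\<in>P. \<forall>\<psi>\<in>P. (\<lambda>x. \<phi> x + \<psi> x) \<in> P) \<and>
     (\<forall>c. \<forall>\<phi>\<in>P. (\<lambda>x. c * \<phi> x) \<in> P) \<and>
     (\<forall>f. \<forall>\<psi>\<in>dual_space. (\<forall>n. f n \<in> P) \<and>
        (\<lambda>n. onorm (\<lambda>x. f n x - \<psi> x)) \<longlonglongrightarrow> 0 \<longrightarrow> \<psi> \<in> P) \<and>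
     (\<forall>x. norm x = (SUP \<phi>\<in>{\<phi>\<in>P. onorm \<phi> \<le> 1}. cmod (\<phi> x))) \<and>
     (\<forall>\<Phi>. (\<forall>\<phi>\<in>P. \<forall>\<psi>\<in>P. \<Phi> (\<lambda>x. \<phi> x + \<psi> x) = \<Phi> \<phi> + \<Phi> \<psi>) \<and>
          (\<forall>c. \<forall>\<phi>\<in>P. \<Phi> (\<lambda>x. c * \<phi> x) = c * \<Phi> \<phi>) \<and>
          (\<exists>K. \<forall>\<phi>\<in>P. cmod (\<Phi> \<phi>) \<le> K * onorm \<phi>)
        \<longrightarrow> (\<exists>x. \<forall>\<phi>\<in>P. \<Phi> \<phi> = \<phi> x))"

locale wstar_probability_space =
  fixes \<tau> :: "'a::cstar_algebra \<Rightarrow> complex"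
  assumes normal: "\<exists>P. predual P \<and> \<tau> \<in> P"
    and unital: "\<tau> 1 = 1"
    and positive: "\<tau> (star x * x) \<in> \<real>" "Re (\<tau> (star x * x)) \<ge> 0"
    and faithful: "\<tau> (star x * x) = 0 \<Longrightarrow> x = 0"
    and tracial: "\<tau> (x * y) = \<tau> (y * x)"

definition self_adjoint :: "'a::cstar_algebra \<Rightarrow> bool" where
  "self_adjoint x \<longleftrightarrow> star x = x"

definition unitary :: "'a::cstar_algebra \<Rightarrow> bool" where
  "unitary x \<longleftrightarrow> star x * x = 1 \<and> x * star x = 1"

definition symmetry :: "'a::cstar_algebra \<Rightarrow> bool" where
  "symmetry x \<longleftrightarrow> self_adjoint x \<and> unitary x"

definition norm2 :: "('a::cstar_algebra \<Rightarrow> complex) \<Rightarrow> 'a \<Rightarrow> real" where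
  "norm2 \<tau> x = sqrt (Re (\<tau> (star x * x)))"

text \<open>
  The spectral distribution of a normal element \<open>x\<close>: the compactly supported probability measure
  on the complex plane whose *-moments are those of \<open>x\<close>. It is carried by the spectrum, hence by
  the unit circle for unitary \<open>x\<close> and by the real line for self-adjoint \<open>x\<close>.
\<close>

definition spectral_distribution ::
  "('a::cstar_algebra \<Rightarrow> complex) \<Rightarrow> 'a \<Rightarrow> complex measure \<Rightarrow> bool" where
  "spectral_distribution \<tau> x \<mu> \<longleftrightarrow>
     prob_space \<mu> \<and> sets \<mu> = sets borel \<and> (\<exists>r. AE z in \<mu>. cmod z \<le> r) \<and>
     (\<forall>m n. \<tau> (x ^ m * star x ^ n) = (\<integral>z. z ^ m * cnj z ^ n \<partial>\<mu>))"

section \<open>Free independence\<close>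

definition star_subalgebra :: "'a::cstar_algebra set \<Rightarrow> bool" where
  "star_subalgebra N \<longleftrightarrow> 1 \<in> N \<and>
     (\<forall>x\<in>N. \<forall>y\<in>N. x + y \<in> N \<and> x * y \<in> N) \<and> (\<forall>c. \<forall>x\<in>N. c *\<^sub>C x \<in> N) \<and> (\<forall>x\<in>N. star x \<in> N)"

definition free_subalgebras ::
  "('a::cstar_algebra \<Rightarrow> complex) \<Rightarrow> 'i set \<Rightarrow> ('i \<Rightarrow> 'a set) \<Rightarrow> bool" where
  "free_subalgebras \<tau> I N \<longleftrightarrow>
     (\<forall>w :: ('i \<times> 'a) list. w \<noteq> [] \<and> distinct_adj (map fst w) \<and>
        (\<forall>(i, x)\<in>set w. i \<in> I \<and> x \<in> N i \<and> \<tau> x = 0) \<longrightarrow> \<tau> (prod_list (map snd w)) = 0)"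

text \<open>
  Two sets are free when the unital *-algebras they generate are free; for a normal faithful trace
  this is equivalent to freeness of the generated von Neumann algebras.
\<close>

definition freely_independent ::
  "('a::cstar_algebra \<Rightarrow> complex) \<Rightarrow> 'a set \<Rightarrow> 'a set \<Rightarrow> bool" where
  "freely_independent \<tau> X Y \<longleftrightarrow>
     free_subalgebras \<tau> UNIV (\<lambda>b. star_subalgebra hull (if b then X else Y))"

section \<open>Free additive and free unitary Brownian motion\<close>

text \<open>The semicircle law of mean zero and variance \<open>v\<close>, for \<open>v > 0\<close>.\<close>

definition semicircle_law :: "real \<Rightarrow> real measure" where
  "semicircle_law v = density lborel
     (\<lambda>x. ennreal (indicator {- 2 * sqrt v..2 * sqrt v} x * (sqrt (4 * v - x\<^sup>2) / (2 * pi * v))))"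

text \<open>
  The filtration \<open>F\<close> is allowed to be any increasing family of unital *-subalgebras; in particular
  it can be the von Neumann algebra filtration generated by \<open>B\<close>.
\<close>

definition free_brownian_motion ::
  "('a::cstar_algebra \<Rightarrow> complex) \<Rightarrow> (real \<Rightarrow> 'a set) \<Rightarrow> (real \<Rightarrow> 'a) \<Rightarrow> bool" where
  "free_brownian_motion \<tau> F B \<longleftrightarrow>
     (\<forall>t\<ge>0. star_subalgebra (F t)) \<and> (\<forall>s t. 0 \<le> s \<and> s \<le> t \<longrightarrow> F s \<subseteq> F t) \<and>
     B 0 = 0 \<and> (\<forall>t\<ge>0. B t \<in> F t \<and> self_adjoint (B t)) \<and>
     (\<forall>s t. 0 \<le> s \<and> s < t \<longrightarrow>
        spectral_distribution \<tau> (B t - B s) (distr (semicircle_law (t - s)) borel complex_of_real) \<and>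
        freely_independent \<tau> {B t - B s} (F s))"

text \<open>
  A simple adapted process on \<open>[0, t]\<close> is given by partition points \<open>p 0 \<le> \<dots> \<le> p n\<close> and
  coefficients \<open>a k\<close>, the value on \<open>[p k, p (k + 1))\<close>.
\<close>

definition adapted_partition ::
  "(real \<Rightarrow> 'a::cstar_algebra set) \<Rightarrow> real \<Rightarrow> nat \<Rightarrow> (nat \<Rightarrow> real) \<Rightarrow> (nat \<Rightarrow> 'a) \<Rightarrow> bool" where
  "adapted_partition F t n p a \<longleftrightarrow>
     p 0 = 0 \<and> p n = t \<and> (\<forall>k<n. p k \<le> p (Suc k) \<and> a k \<in> F (p k))"

definition simple_process ::
  "nat \<Rightarrow> (nat \<Rightarrow> real) \<Rightarrow> (nat \<Rightarrow> 'a::cstar_algebra) \<Rightarrow> real \<Rightarrow> 'a" where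
  "simple_process n p a s = (\<Sum>k<n. indicator {p k..<p (Suc k)} s *\<^sub>R a k)"

definition simple_free_integral ::
  "(real \<Rightarrow> 'a::cstar_algebra) \<Rightarrow> nat \<Rightarrow> (nat \<Rightarrow> real) \<Rightarrow> (nat \<Rightarrow> 'a) \<Rightarrow> 'a" where
  "simple_free_integral B n p a = (\<Sum>k<n. a k * (B (p (Suc k)) - B (p k)))"

text \<open>
  The free stochastic integral \<open>X = \<integral>\<^sub>0\<^sup>t f\<^sub>s dB\<^sub>s\<close> (of the biprocess \<open>f \<otimes> 1\<close>), as the
  \<open>L\<^sup>2\<close>-extension of the integral of simple adapted processes. By the free Ito isometry and
  faithfulness of \<open>\<tau>\<close>, \<open>X\<close> does not depend on the approximating sequence.
\<close>

definition has_free_integral ::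
  "('a::cstar_algebra \<Rightarrow> complex) \<Rightarrow> (real \<Rightarrow> 'a set) \<Rightarrow> (real \<Rightarrow> 'a) \<Rightarrow> real \<Rightarrow> (real \<Rightarrow> 'a) \<Rightarrow> 'a \<Rightarrow> bool"
  where
  "has_free_integral \<tau> F B t f X \<longleftrightarrow>
     (\<exists>n p a. (\<forall>m. adapted_partition F t (n m) (p m) (a m)) \<and>
        (\<lambda>m. \<integral>\<^sup>+s\<in>{0..t}. ennreal ((norm2 \<tau> (simple_process (n m) (p m) (a m) s - f s))\<^sup>2) \<partial>lborel)
          \<longlonglongrightarrow> 0 \<and>
        (\<lambda>m. norm2 \<tau> (simple_free_integral B (n m) (p m) (a m) - X)) \<longlonglongrightarrow> 0)"

text \<open>
  The equation \<open>dU\<^sub>t = i U\<^sub>t dB\<^sub>t - U\<^sub>t dt / 2\<close> in integrated form, for a norm-continuous adapted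
  process of unitaries.
\<close>

definition free_unitary_brownian_motion ::
  "('a::cstar_algebra \<Rightarrow> complex) \<Rightarrow> (real \<Rightarrow> 'a) \<Rightarrow> bool" where
  "free_unitary_brownian_motion \<tau> U \<longleftrightarrow>
     U 0 = 1 \<and> continuous_on {0..} U \<and> (\<forall>t\<ge>0. unitary (U t)) \<and>
     (\<exists>F B. free_brownian_motion \<tau> F B \<and> (\<forall>t\<ge>0. U t \<in> F t) \<and>
        (\<forall>t\<ge>0. \<exists>X. has_free_integral \<tau> F B t (\<lambda>s. \<i> *\<^sub>C U s) X \<and>
           U t - 1 = X - (1/2) *\<^sub>R integral {0..t} U))"

section \<open>Measures\<close>

definition weakly_converges ::
  "('b \<Rightarrow> 'c::topological_space measure) \<Rightarrow> 'c measure \<Rightarrow> 'b filter \<Rightarrow> bool" where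
  "weakly_converges M N G \<longleftrightarrow>
     (\<forall>f :: 'c \<Rightarrow> real. continuous_on UNIV f \<and> bounded (range f) \<longrightarrow>
        ((\<lambda>t. \<integral>x. f x \<partial>M t) \<longlongrightarrow> (\<integral>x. f x \<partial>N)) G)"

definition add_measure :: "'b measure \<Rightarrow> 'b measure \<Rightarrow> 'b measure" where
  "add_measure M N = measure_of (space M) (sets M) (\<lambda>A. emeasure M A + emeasure N A)"

lemma sets_add_measure [simp, measurable_cong]: "sets (add_measure M N) = sets M"
  and space_add_measure [simp]: "space (add_measure M N) = space M"
  by (simp_all add: add_measure_def)

lemma emeasure_add_measure:
  assumes "sets M = sets N"
  shows "emeasure (add_measure M N) A = emeasure M A + emeasure N A"
proof (cases "A \<in> sets M")
  case True
  show ?thesis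
  proof (rule emeasure_measure_of[OF add_measure_def])
    show "countably_additive (sets (add_measure M N)) (\<lambda>A. emeasure M A + emeasure N A)"
    proof (rule countably_additiveI)
      fix A :: "nat \<Rightarrow> 'a set"
      assume A: "range A \<subseteq> sets (add_measure M N)" "disjoint_family A"
      then have "range A \<subseteq> sets M" "range A \<subseteq> sets N"
        using assms by auto
      with A show "(\<Sum>i. emeasure M (A i) + emeasure N (A i)) =
          emeasure M (\<Union>i. A i) + emeasure N (\<Union>i. A i)"
        by (simp add: suminf_add[symmetric] suminf_emeasure)
    qed
  qed (use True in \<open>auto simp: positive_def dest: sets.sets_into_space\<close>)
next
  case False
  with assms show ?thesis
    by (simp add: emeasure_notin_sets)
qed

end

theory Submission
  imports Defs
begin

text \<open>
  The stochastic integral has trace 0, so \<open>\<tau> (U t) = exp (- t / 2)\<close> tends to 0, and \<open>U t\<close> may be replaced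
  by its centring; hence \<open>R\<close> and \<open>U t * S * star (U t)\<close> are free in the limit. Freeness is the vanishing
  of the liberation gradient; on the word \<open>(R V)\<^sup>n\<close> in two free symmetries this is a quadratic
  recursion for the moments, equivalent to the formula for the square \<open>H\<^sup>2\<close> of the Herglotz transform.
  As \<open>Re H \<ge> 0\<close>, this determines \<open>Re H = sqrt ((\<bar>H\<^sup>2\<bar> + Re (H\<^sup>2)) / 2)\<close>, which is continuous on the
  closed disc minus \<open>1\<close> and \<open>-1\<close>. The measures with density \<open>Re H (r \<zeta>)\<close> with respect to normalised Haar
  measure converge weakly to the law as \<open>r\<close> tends to 1, which gives the density away from \<open>1\<close> and \<open>-1\<close>;
  the atoms at these points are radial limits of \<open>(1 - r) / 2 * H\<close>.
\<close>

section \<open>Traces on C*-algebras\<close>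

text \<open>Why the liberation gradient: freeness speaks about centred alternating words, and
  expanding (R V)^n into such words gets more complicated with every n. The gradient is a
  derivation, so its vanishing can be checked on centred alternating words and then read off on (R
  V)^n itself, where traciality makes all pieces of odd length explicit. With \<psi> the generating
  function of the moments and H = 2 \<psi> - 1, the recursion is an equation for \<psi> (\<psi> -
  1), and H^2 = 1 + 4 \<psi> (\<psi> - 1); no single moment is ever computed. Working with Re H is
  enough because it is the Poisson integral of the law, so no branch of the root has to be followed
  to the circle. The obstacle at the boundary is that H^2 can have poles at 1 and -1. No uniform
  bound is available there, hence the split into test functions that vanish near these two points
  and a separate computation of the two point masses.\<close>

lemma scaleC_one [simp]: "1 *\<^sub>C (x :: 'a::cstar_algebra) = x"
  using scaleC_of_real[of 1 x] by simp

lemma scaleC_zero_left [simp]: "0 *\<^sub>C (x :: 'a::cstar_algebra) = 0"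
  using scaleC_of_real[of 0 x] by simp

lemma scaleC_minus_left: "(- c) *\<^sub>C (x :: 'a::cstar_algebra) = - (c *\<^sub>C x)"
  using scaleC_add_left[of c "-c" x] by (simp add: minus_unique)

lemma scaleC_diff_right: "c *\<^sub>C (x - y :: 'a::cstar_algebra) = c *\<^sub>C x - c *\<^sub>C y"
  using scaleC_add_right[of c "x - y" y] by (simp add: algebra_simps)

lemma star_zero [simp]: "star (0 :: 'a::cstar_algebra) = 0"
  using star_add[of 0 "0::'a"] by simp

lemma star_one [simp]: "star (1 :: 'a::cstar_algebra) = 1"
  using star_mult[of "star 1" "1::'a"] by (simp add: star_star)

lemma star_minus: "star (- x :: 'a::cstar_algebra) = - star x"
  using star_add[of x "-x"] by (simp add: minus_unique)

lemma star_diff: "star (x - y :: 'a::cstar_algebra) = star x - star y"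
  using star_add[of x "-y"] by (simp add: star_minus)

lemma star_power: "star (x ^ n :: 'a::cstar_algebra) = star x ^ n"
  by (induction n) (simp_all add: star_mult power_commutes)

lemma norm_unitary:
  assumes "unitary (x :: 'a::cstar_algebra)"
  shows "norm x = 1"
proof -
  have "(norm x)\<^sup>2 = 1"
    using cstar_identity[of x] assms by (simp add: unitary_def)
  then show ?thesis
    by (simp add: power2_eq_1_iff) (use norm_ge_zero[of x] in linarith)
qed

lemma unitary_star: "unitary (x :: 'a::cstar_algebra) \<Longrightarrow> unitary (star x)"
  by (simp add: unitary_def star_star)

lemma unitary_mult:
  assumes "unitary (x :: 'a::cstar_algebra)" "unitary y"
  shows "unitary (x * y)"
proof -
  have "star y * star x * (x * y) = star y * (star x * x) * y"
    and "x * y * (star y * star x) = x * (y * star y) * star x"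
    by (simp_all only: mult.assoc)
  with assms show ?thesis
    by (simp add: unitary_def star_mult)
qed

lemma unitary_power: "unitary (x :: 'a::cstar_algebra) \<Longrightarrow> unitary (x ^ n)"
  by (induction n) (simp_all add: unitary_mult unitary_def[of 1])

lemma symmetry_square: "symmetry x \<Longrightarrow> x * x = 1"
  unfolding symmetry_def self_adjoint_def unitary_def by metis

lemma symmetry_conj:
  assumes "unitary u" "symmetry x"
  shows "symmetry (u * x * star u)"
  using assms by (auto simp: symmetry_def self_adjoint_def star_mult star_star mult.assoc
      intro!: unitary_mult unitary_star)

lemma star_subalgebra_hull: "star_subalgebra (star_subalgebra hull X)"
  by (rule hull_in) (auto simp: star_subalgebra_def)

lemma star_subalgebra_diff_scaleC:
  assumes "star_subalgebra N" "x \<in> N"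
  shows "x - c *\<^sub>C 1 \<in> N"
proof -
  have "x - c *\<^sub>C 1 = x + (-c) *\<^sub>C 1"
    by (simp add: scaleC_minus_left)
  with assms show ?thesis
    unfolding star_subalgebra_def by metis
qed

context wstar_probability_space
begin

lemma \<tau>_dual: "\<tau> \<in> dual_space"
  using normal by (auto simp: predual_def)

lemma \<tau>_bounded_linear: "bounded_linear \<tau>"
  using \<tau>_dual by (simp add: dual_space_def)

lemma \<tau>_scaleC [simp]: "\<tau> (c *\<^sub>C x) = c * \<tau> x"
  using \<tau>_dual by (simp add: dual_space_def)

lemmas \<tau>_add [simp] = linear_add[OF bounded_linear.linear[OF \<tau>_bounded_linear]]
  and \<tau>_diff [simp] = linear_diff[OF bounded_linear.linear[OF \<tau>_bounded_linear]]
  and \<tau>_zero [simp] = linear_0[OF bounded_linear.linear[OF \<tau>_bounded_linear]]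
  and \<tau>_sum = linear_sum[OF bounded_linear.linear[OF \<tau>_bounded_linear]]

lemmas \<tau>_one [simp] = unital

text \<open>Polarisation: \<open>\<tau> (star y * y)\<close> is real for y = x, y = x + \<i> and y =
  x + 1. Comparing imaginary parts gives the real and the imaginary part of the claim.\<close>

lemma \<tau>_star: "\<tau> (star x) = cnj (\<tau> x)"
proof (rule complex_eqI)
  have real: "Im (\<tau> (star y * y)) = 0" for y
    using positive(1)[of y] by (simp add: complex_is_Real_iff)
  have "star (x + \<i> *\<^sub>C 1) * (x + \<i> *\<^sub>C 1) = star x * x + \<i> *\<^sub>C star x + (- \<i>) *\<^sub>C x + 1"
    by (simp add: star_add star_scaleC algebra_simps mult_scaleC_left mult_scaleC_right
        scaleC_scaleC scaleC_add_right scaleC_diff_right scaleC_minus_left)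
  then have "Im (\<tau> (star x * x)) + Re (\<tau> (star x)) - Re (\<tau> x) = 0"
    using real[of "x + \<i> *\<^sub>C 1"] by simp
  then show "Re (\<tau> (star x)) = Re (cnj (\<tau> x))"
    using real[of x] by simp
  have "star (x + 1) * (x + 1) = star x * x + star x + x + 1"
    by (simp add: star_add algebra_simps)
  then have "Im (\<tau> (star x * x)) + Im (\<tau> (star x)) + Im (\<tau> x) = 0"
    using real[of "x + 1"] by simp
  then show "Im (\<tau> (star x)) = Im (cnj (\<tau> x))"
    using real[of x] by simp
qed

text \<open>The variance of x is nonnegative: expand \<open>star (x - c) * (x - c)\<close> with c
  the trace of x. This carries trace identities through the L2 limit that defines the stochastic
  integral.\<close>

lemma cmod_\<tau>_le_norm2: "cmod (\<tau> x) \<le> norm2 \<tau> x"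
proof -
  define c where "c = \<tau> x"
  have "star (x - c *\<^sub>C 1) * (x - c *\<^sub>C 1)
      = star x * x - c *\<^sub>C star x - cnj c *\<^sub>C x + (cnj c * c) *\<^sub>C 1"
    by (simp add: star_diff star_scaleC algebra_simps mult_scaleC_left mult_scaleC_right
        scaleC_scaleC scaleC_diff_right)
  then have "0 \<le> Re (\<tau> (star x * x) - c * cnj c - cnj c * c + cnj c * c)"
    using positive(2)[of "x - c *\<^sub>C 1"] by (simp add: \<tau>_star flip: c_def)
  then have "(cmod c)\<^sup>2 \<le> Re (\<tau> (star x * x))"
    by (simp add: cmod_power2) (simp add: power2_eq_square)
  then show ?thesis
    unfolding norm2_def c_def by (rule real_le_rsqrt)
qed

lemma cmod_\<tau>_unitary: "unitary x \<Longrightarrow> cmod (\<tau> x) \<le> 1"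
  using cmod_\<tau>_le_norm2[of x] by (simp add: norm2_def unitary_def)

lemma \<tau>_conj: "unitary u \<Longrightarrow> \<tau> (u * x * star u) = \<tau> x"
  by (subst tracial) (simp add: unitary_def flip: mult.assoc)

text \<open>The product of the two centred elements is an alternating word of length two, so its
  trace vanishes; expanding it gives the factorisation.\<close>

lemma freely_independent_\<tau>_mult:
  assumes "freely_independent \<tau> X Y" "x \<in> X" "y \<in> Y"
  shows "\<tau> (y * x) = \<tau> y * \<tau> x"
proof -
  define x' y' where "x' = x - \<tau> x *\<^sub>C 1" and "y' = y - \<tau> y *\<^sub>C 1"
  have "x' \<in> star_subalgebra hull X" "y' \<in> star_subalgebra hull Y"
    unfolding x'_def y'_def using assms(2,3)
    by (simp_all add: star_subalgebra_diff_scaleC[OF star_subalgebra_hull] hull_inc)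
  then have "\<tau> (prod_list (map snd [(False, y'), (True, x')])) = 0"
    using assms(1) unfolding freely_independent_def free_subalgebras_def
    by (elim allE[of _ "[(False, y'), (True, x')]"]) (simp add: x'_def y'_def)
  then have "\<tau> (y' * x') = 0"
    by simp
  moreover have "y' * x' = y * x - \<tau> x *\<^sub>C y - \<tau> y *\<^sub>C x + (\<tau> y * \<tau> x) *\<^sub>C 1"
    by (simp add: x'_def y'_def algebra_simps mult_scaleC_left mult_scaleC_right
        scaleC_scaleC scaleC_diff_right)
  ultimately show ?thesis
    by (simp add: algebra_simps)
qed

end

section \<open>The trace of free unitary Brownian motion\<close>

lemma integral_semicircle_law: "(\<integral>z. z \<partial>distr (semicircle_law v) borel complex_of_real) = 0"
proof -
  define g :: "real \<Rightarrow> real" where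
    "g x = indicator {- 2 * sqrt v..2 * sqrt v} x * (sqrt (4 * v - x\<^sup>2) / (2 * pi * v))" for x
  show ?thesis
  proof (cases "v \<ge> 0")
    case True
    have g: "g \<in> borel_measurable borel" "\<And>x. 0 \<le> g x"
    proof -
      show "g \<in> borel_measurable borel"
        unfolding g_def by measurable
      fix x
      have "x\<^sup>2 \<le> 4 * v" if "- 2 * sqrt v \<le> x" "x \<le> 2 * sqrt v"
      proof -
        have "\<bar>x\<bar>\<^sup>2 \<le> (2 * sqrt v)\<^sup>2"
          using that by (intro power_mono) auto
        with True show ?thesis by (simp add: power_mult_distrib)
      qed
      with True show "0 \<le> g x"
        by (auto simp: g_def indicator_def)
    qed
    have g_minus: "g (- x) = g x" for x
      by (auto simp: g_def indicator_def)
    have "(\<integral>z. z \<partial>distr (semicircle_law v) borel complex_of_real)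
        = (\<integral>x. complex_of_real x \<partial>density lborel (\<lambda>x. ennreal (g x)))"
      unfolding semicircle_law_def g_def by (subst integral_distr) auto
    also have "\<dots> = (\<integral>x. g x *\<^sub>R complex_of_real x \<partial>lborel)"
      using g by (subst integral_density) auto
    also have "\<dots> = 0"
    proof -
      have "(\<integral>x. g x *\<^sub>R complex_of_real x \<partial>lborel)
          = (\<integral>x. - (g x *\<^sub>R complex_of_real x) \<partial>lborel)"
        by (subst lborel_integral_real_affine[of "-1" _ 0]) (auto simp: g_minus)
      also have "\<dots> = - (\<integral>x. g x *\<^sub>R complex_of_real x \<partial>lborel)"
        by (rule integral_minus)
      finally show ?thesis
        by (simp add: eq_neg_iff_add_eq_0 flip: mult_2)
    qed
    finally show ?thesis .
  next
    \<comment> \<open>For negative v the total function \<open>sqrt\<close> takes a negative value,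
      so the interval in the indicator is empty and the law is the zero measure.\<close>
    case False
    have "g x \<le> 0" for x
      using False by (auto simp: g_def indicator_def)
    then have "(\<lambda>x. ennreal (g x)) = (\<lambda>x. 0)"
      by (auto simp: ennreal_neg)
    then have "semicircle_law v = null_measure lborel"
      unfolding semicircle_law_def g_def null_measure_eq_density by simp
    then show ?thesis
      by (simp add: integral_distr)
  qed
qed

context wstar_probability_space
begin

text \<open>Adaptedness puts each coefficient into the algebra at the left end point, which is free
  from the following increment. The trace of each summand factors, and the increment has mean
  0.\<close>

lemma \<tau>_simple_free_integral:
  assumes B: "free_brownian_motion \<tau> F B" and p: "adapted_partition F t n p a"
  shows "\<tau> (simple_free_integral B n p a) = 0"
proof -
  have "\<tau> (a k * (B (p (Suc k)) - B (p k))) = 0" if "k < n" for k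
  proof -
    have "j \<le> n \<Longrightarrow> 0 \<le> p j" for j
    proof (induction j)
      case (Suc j)
      then have "p j \<le> p (Suc j)"
        using p by (auto simp: adapted_partition_def)
      with Suc show ?case by linarith
    qed (use p in \<open>simp add: adapted_partition_def\<close>)
    then have pk: "0 \<le> p k" "p k \<le> p (Suc k)" "a k \<in> F (p k)"
      using p that by (auto simp: adapted_partition_def)
    show ?thesis
    proof (cases "p k = p (Suc k)")
      case False
      with pk have "p k < p (Suc k)" by simp
      then have sd: "spectral_distribution \<tau> (B (p (Suc k)) - B (p k))
            (distr (semicircle_law (p (Suc k) - p k)) borel complex_of_real)"
        and free: "freely_independent \<tau> {B (p (Suc k)) - B (p k)} (F (p k))"
        using B pk(1) by (auto simp: free_brownian_motion_def)
      from sd have "\<tau> ((B (p (Suc k)) - B (p k)) ^ 1 * star (B (p (Suc k)) - B (p k)) ^ 0)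
          = (\<integral>z. z ^ 1 * cnj z ^ 0 \<partial>distr (semicircle_law (p (Suc k) - p k)) borel complex_of_real)"
        unfolding spectral_distribution_def by blast
      then have "\<tau> (B (p (Suc k)) - B (p k)) = 0"
        using integral_semicircle_law[of "p (Suc k) - p k"] by simp
      then show ?thesis
        using freely_independent_\<tau>_mult[OF free _ pk(3)] by simp
    qed simp
  qed
  then show ?thesis
    by (simp add: simple_free_integral_def \<tau>_sum del: \<tau>_diff)
qed

text \<open>The trace is bounded by the L2 norm, so its vanishing on simple integrals survives the
  limit.\<close>

lemma \<tau>_free_integral:
  assumes B: "free_brownian_motion \<tau> F B" and X: "has_free_integral \<tau> F B t f X"
  shows "\<tau> X = 0"
proof -
  from X obtain n p a where p: "\<And>m. adapted_partition F t (n m) (p m) (a m)"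
    and lim: "(\<lambda>m. norm2 \<tau> (simple_free_integral B (n m) (p m) (a m) - X)) \<longlonglongrightarrow> 0"
    unfolding has_free_integral_def by blast
  have "cmod (\<tau> X) \<le> norm2 \<tau> (simple_free_integral B (n m) (p m) (a m) - X)" for m
    using cmod_\<tau>_le_norm2[of "simple_free_integral B (n m) (p m) (a m) - X"]
      \<tau>_simple_free_integral[OF B p[of m]] by simp
  then have "cmod (\<tau> X) \<le> 0"
    by (intro LIMSEQ_le_const[OF lim]) auto
  then show ?thesis by simp
qed

text \<open>The trace kills the stochastic integral, which leaves the scalar equation g = 1 - (1/2)
  \<integral> g for the trace g of U. Multiplying g by the integrating factor exp (s / 2) gives a
  constant.\<close>

lemma \<tau>_free_unitary_brownian_motion:
  assumes U: "free_unitary_brownian_motion \<tau> U" and "t \<ge> 0"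
  shows "\<tau> (U t) = exp (- complex_of_real t / 2)"
proof -
  define g where "g t = \<tau> (U t)" for t
  have cont: "continuous_on {0..} U"
    using U by (simp add: free_unitary_brownian_motion_def)
  have contg: "continuous_on {0..} g"
    unfolding g_def by (intro bounded_linear.continuous_on[OF \<tau>_bounded_linear] cont)
  have g_eq: "g s = 1 - (1/2) *\<^sub>R integral {0..s} g" if "s \<ge> 0" for s
  proof -
    from U obtain F B where "free_brownian_motion \<tau> F B"
      and "\<forall>t\<ge>0. \<exists>X. has_free_integral \<tau> F B t (\<lambda>s. \<i> *\<^sub>C U s) X \<and>
           U t - 1 = X - (1/2) *\<^sub>R integral {0..t} U"
      unfolding free_unitary_brownian_motion_def by (elim conjE exE)
    with that obtain X where "free_brownian_motion \<tau> F B"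
      and "has_free_integral \<tau> F B s (\<lambda>s. \<i> *\<^sub>C U s) X"
      and X: "U s - 1 = X - (1/2) *\<^sub>R integral {0..s} U"
      by metis
    then have "\<tau> X = 0"
      using \<tau>_free_integral by blast
    moreover have "U integrable_on {0..s}"
      by (intro integrable_continuous_interval continuous_on_subset[OF cont]) auto
    then have "\<tau> (integral {0..s} U) = integral {0..s} g"
      using integral_linear[OF _ \<tau>_bounded_linear, of U "{0..s}"] by (simp add: o_def g_def[abs_def])
    ultimately have "\<tau> (U s - 1) = - (1/2) *\<^sub>R integral {0..s} g"
      unfolding X by (simp add: linear_scale[OF bounded_linear.linear[OF \<tau>_bounded_linear]])
    then show ?thesis
      by (simp add: g_def algebra_simps)
  qed
  have deriv: "(g has_vector_derivative (- (1/2) *\<^sub>R g s)) (at s within {0..t})" if "s \<in> {0..t}" for s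
  proof (rule has_vector_derivative_transform[OF that])
    show "g s = 1 - (1/2) *\<^sub>R integral {0..s} g" if "s \<in> {0..t}" for s
      using g_eq[of s] that by auto
    have "((\<lambda>s. integral {0..s} g) has_vector_derivative g s) (at s within {0..t})"
      by (rule integral_has_vector_derivative[OF continuous_on_subset[OF contg] that]) auto
    from has_vector_derivative_diff[OF has_vector_derivative_const
        has_vector_derivative_scaleR[OF DERIV_const this], of 1 "1/2"]
    show "((\<lambda>s. 1 - (1/2) *\<^sub>R integral {0..s} g) has_vector_derivative (- (1/2) *\<^sub>R g s))
        (at s within {0..t})"
      by simp
  qed
  have "((\<lambda>s. exp (s / 2) *\<^sub>R g s) has_vector_derivative 0) (at s within {0..t})"
    if s: "s \<in> {0..t}" for s
  proof -
    have "((\<lambda>s. exp (s / 2)) has_real_derivative exp (s / 2) / 2) (at s within {0..t})"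
      by (auto intro!: derivative_eq_intros)
    from has_vector_derivative_scaleR[OF this deriv[OF s]] show ?thesis
      by simp
  qed
  then obtain c where c: "\<And>s. s \<in> {0..t} \<Longrightarrow> exp (s / 2) *\<^sub>R g s = c"
    using has_vector_derivative_zero_constant[of "{0..t}" "\<lambda>s. exp (s / 2) *\<^sub>R g s"] by auto
  have "exp (t / 2) *\<^sub>R g t = exp (0 / 2) *\<^sub>R g 0"
    using c[of t] c[of 0] \<open>t \<ge> 0\<close> by simp
  moreover have "g 0 = 1"
    using U by (simp add: g_def free_unitary_brownian_motion_def)
  ultimately have "complex_of_real (exp (t/2)) * g t = 1"
    by (simp add: scaleR_conv_of_real)
  then have "g t = complex_of_real (exp (- t / 2))"
    by (simp add: exp_minus field_simps)
  also have "\<dots> = exp (- complex_of_real t / 2)"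
    by (simp flip: exp_of_real)
  finally show ?thesis
    by (simp add: g_def)
qed

end

section \<open>The liberation gradient\<close>

lemma not_distinct_adj_mapE:
  assumes "\<not> distinct_adj (map f w)"
  obtains p x y q where "w = p @ x # y # q" "f x = f y"
proof -
  have "\<exists>p x y q. w = p @ x # y # q \<and> f x = f y"
    using assms
  proof (induction w)
    case (Cons x w)
    show ?case
    proof (cases "distinct_adj (map f w)")
      case True
      with Cons.prems have "w \<noteq> []" "f x = f (hd w)"
        by (auto simp: distinct_adj_Cons hd_map)
      then show ?thesis
        by (intro exI[of _ "[]"] exI[of _ x] exI[of _ "hd w"] exI[of _ "tl w"]) auto
    next
      case False
      with Cons.IH show ?thesis
        by (metis append_Cons)
    qed
  qed simp
  with that show thesis by blast
qed

text \<open>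
  With \<open>\<partial>\<close> the derivation that is \<open>x \<mapsto> x \<otimes> 1 - 1 \<otimes> x\<close> on letters marked \<open>True\<close> and vanishes on
  letters marked \<open>False\<close>, this is \<open>(\<tau> \<otimes> \<tau>)\<close> applied to \<open>(u \<otimes> 1) \<partial>(w) (1 \<otimes> v)\<close>.
\<close>

fun liberation :: "('a::cstar_algebra \<Rightarrow> complex) \<Rightarrow> 'a \<Rightarrow> (bool \<times> 'a) list \<Rightarrow> 'a \<Rightarrow> complex" where
  "liberation \<tau> u [] v = 0"
| "liberation \<tau> u ((b, x) # w) v =
     (if b then \<tau> (u * x) * \<tau> (prod_list (map snd w) * v)
        - \<tau> u * \<tau> (x * prod_list (map snd w) * v) else 0)
     + liberation \<tau> (u * x) w v"

text \<open>The Leibniz rule of the derivation. The rules for modifying a single letter inside a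
  word all come from it.\<close>

lemma liberation_append:
  "liberation \<tau> u (p @ q) v =
     liberation \<tau> u p (prod_list (map snd q) * v) + liberation \<tau> (u * prod_list (map snd p)) q v"
  by (induction p arbitrary: u) (auto simp: mult.assoc)

text \<open>A symmetry squares to 1, so the algebra that it generates is spanned by 1 and itself,
  and two coefficients describe any element; products of letters over the same symmetry are letters
  again. The coefficients do not involve the second symmetry, so one word can be evaluated along a
  whole family of them.\<close>

type_synonym letter = "bool \<times> complex \<times> complex"

definition eval_letter :: "'a::cstar_algebra \<Rightarrow> 'a \<Rightarrow> letter \<Rightarrow> bool \<times> 'a" where
  "eval_letter x y = (\<lambda>(b, c, d). (b, c *\<^sub>C 1 + d *\<^sub>C (if b then x else y)))"

definition eval_word :: "'a::cstar_algebra \<Rightarrow> 'a \<Rightarrow> letter list \<Rightarrow> 'a" where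
  "eval_word x y w = prod_list (map (snd \<circ> eval_letter x y) w)"

definition centred :: "complex \<Rightarrow> complex \<Rightarrow> letter \<Rightarrow> bool" where
  "centred \<alpha> \<beta> = (\<lambda>(b, c, d). c + d * (if b then \<alpha> else \<beta>) = 0)"

lemma eval_word_simps [simp]:
  "eval_word x y [] = 1"
  "eval_word x y (l # w) = snd (eval_letter x y l) * eval_word x y w"
  "eval_word x y (p @ q) = eval_word x y p * eval_word x y q"
  by (simp_all add: eval_word_def)

lemma prod_list_eval_letter:
  "prod_list (map snd (map (eval_letter x y) w)) = eval_word x y w"
  by (simp add: eval_word_def)

lemma fst_eval_letter [simp]: "fst (eval_letter x y l) = fst l"
  by (simp add: eval_letter_def split: prod.split)

section \<open>Algebraic rules for the liberation gradient and its vanishing in the limit\<close>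

context wstar_probability_space
begin

lemma liberation_add_left:
  "liberation \<tau> (u + u') w v = liberation \<tau> u w v + liberation \<tau> u' w v"
  by (induction w arbitrary: u u') (auto simp: algebra_simps)

lemma liberation_add_right:
  "liberation \<tau> u w (v + v') = liberation \<tau> u w v + liberation \<tau> u w v'"
  by (induction w arbitrary: u) (auto simp: algebra_simps)

lemma liberation_scaleC_left:
  "liberation \<tau> (c *\<^sub>C u) w v = c * liberation \<tau> u w v"
  by (induction w arbitrary: u) (auto simp: algebra_simps mult_scaleC_left)

lemma liberation_scaleC_right:
  "liberation \<tau> u w (c *\<^sub>C v) = c * liberation \<tau> u w v"
  by (induction w arbitrary: u) (auto simp: algebra_simps mult_scaleC_right)

lemma liberation_add_letter:
  "liberation \<tau> u (p @ (b, x + y) # q) v =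
     liberation \<tau> u (p @ (b, x) # q) v + liberation \<tau> u (p @ (b, y) # q) v"
  by (simp add: liberation_append liberation_add_left liberation_add_right distrib_left distrib_right)

lemma liberation_scalar_letter:
  "liberation \<tau> u (p @ (b, c *\<^sub>C 1) # q) v = c * liberation \<tau> u (p @ q) v"
  by (simp add: liberation_append liberation_scaleC_left liberation_scaleC_right
      mult_scaleC_left mult_scaleC_right distrib_left)

text \<open>For letters marked \<open>True\<close> the sum telescopes: the terms x \<otimes> y
  produced by the two letters cancel, leaving the derivative of the product.\<close>

lemma liberation_merge:
  "liberation \<tau> u (p @ (b, x) # (b, y) # q) v = liberation \<tau> u (p @ (b, x * y) # q) v"
  by (simp add: liberation_append mult.assoc)

lemma liberation_alternating:
  "liberation \<tau> u (concat (replicate n [(True, x), (False, y)])) v =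
     (\<Sum>k<n. \<tau> (u * (x * y) ^ k * x) * \<tau> (y * (x * y) ^ (n - 1 - k) * v)
       - \<tau> (u * (x * y) ^ k) * \<tau> ((x * y) ^ (n - k) * v))"
proof (induction n arbitrary: u)
  case (Suc n)
  have prod: "prod_list (map snd (concat (replicate n [(True, x), (False, y)]))) = (x * y) ^ n" for n
    by (induction n) (simp_all add: mult.assoc)
  show ?case
    by (simp add: Suc prod sum.lessThan_Suc_shift mult.assoc del: sum.lessThan_Suc)
qed simp

text \<open>
  Voiculescu's characterisation of freeness by a vanishing liberation gradient, for two symmetries
  that are free in the limit: up to merging letters and splitting off scalars, every word is a
  combination of alternating centred words, on which every summand has a factor tending to 0.
\<close>

lemma liberation_tendsto_0:
  fixes Y :: "'b \<Rightarrow> 'a" and G :: "'b filter"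
  assumes X: "X * X = 1" and Y: "\<And>t. Y t * Y t = 1"
    and free: "\<And>w. w \<noteq> [] \<Longrightarrow> distinct_adj (map fst w) \<Longrightarrow> \<forall>l\<in>set w. centred \<alpha> \<beta> l \<Longrightarrow>
      ((\<lambda>t. \<tau> (eval_word X (Y t) w)) \<longlongrightarrow> 0) G"
  shows "((\<lambda>t. liberation \<tau> 1 (map (eval_letter X (Y t)) w) 1) \<longlongrightarrow> 0) G"
proof (induction w rule: length_induct)
  case (1 w)
  define L where "L w t = liberation \<tau> 1 (map (eval_letter X (Y t)) w) 1" for w t
  have IH: "(L w' \<longlongrightarrow> 0) G" if "length w' < length w" for w'
    using 1[rule_format, OF that] by (simp add: L_def[abs_def])
  have "(L w \<longlongrightarrow> 0) G"
  proof (cases "distinct_adj (map fst w)")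
    case False
    then obtain p l l' q where "w = p @ l # l' # q" "fst l = fst l'"
      by (rule not_distinct_adj_mapE)
    moreover obtain b c d where "l = (b, c, d)"
      by (rule prod_cases3)
    moreover obtain b' c' d' where "l' = (b', c', d')"
      by (rule prod_cases3)
    ultimately have w: "w = p @ (b, c, d) # (b, c', d') # q"
      by simp
    have "L w = L (p @ (b, c * c' + d * d', c * d' + d * c') # q)"
    proof
      fix t
      define Z where "Z = (if b then X else Y t)"
      have "Z * Z = 1"
        using X Y by (simp add: Z_def)
      then have "(c *\<^sub>C 1 + d *\<^sub>C Z) * (c' *\<^sub>C 1 + d' *\<^sub>C Z)
          = (c * c' + d * d') *\<^sub>C 1 + (c * d' + d * c') *\<^sub>C Z"
        by (simp add: distrib_left distrib_right mult_scaleC_left mult_scaleC_right scaleC_scaleC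
            scaleC_add_left scaleC_add_right ac_simps)
      moreover have "eval_letter X (Y t) (b, e, f) = (b, e *\<^sub>C 1 + f *\<^sub>C Z)" for e f
        by (simp add: eval_letter_def Z_def)
      ultimately show "L w t = L (p @ (b, c * c' + d * d', c * d' + d * c') # q) t"
        by (simp only: L_def w map_append list.map liberation_merge)
    qed
    then show ?thesis
      using IH[of "p @ (b, c * c' + d * d', c * d' + d * c') # q"] by (simp add: w)
  next
    case True
    \<comment> \<open>The prefix p is already centred; the letters of q are centred one at a time.
      Splitting the scalar off a letter deletes the letter, and the resulting word, alternating or
      not, is shorter and falls under the outer induction.\<close>
    have "(L (p @ q) \<longlongrightarrow> 0) G"
      if "\<forall>l\<in>set p. centred \<alpha> \<beta> l" "distinct_adj (map fst (p @ q))" "length (p @ q) = length w"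
      for p q
      using that
    proof (induction q arbitrary: p)
      case Nil
      \<comment> \<open>Generalised over the part r that has already been absorbed into the left
        factor. In each of the two products one factor is the trace of a nonempty centred
        alternating word.\<close>
      have "((\<lambda>t. liberation \<tau> (eval_word X (Y t) r) (map (eval_letter X (Y t)) s) 1) \<longlongrightarrow> 0) G"
        if "distinct_adj (map fst (r @ s))" "\<forall>l\<in>set (r @ s). centred \<alpha> \<beta> l" for r s
        using that
      proof (induction s arbitrary: r)
        case (Cons l s)
        obtain b z where l: "l = (b, z)" by (rule prod.exhaust)
        have "distinct_adj (map fst (r @ [l]) @ map fst s)" "distinct_adj (map fst r @ map fst (l # s))"
          using Cons.prems(1) by simp_all
        note this[THEN distinct_adj_appendD1] this[THEN distinct_adj_appendD2]
        note adj = this and cent = Cons.prems(2)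
        have lim: "((\<lambda>t. \<tau> (eval_word X (Y t) (r @ [l]))) \<longlongrightarrow> 0) G"
          by (rule free) (use adj cent in auto)
        have lim': "((\<lambda>t. \<tau> (eval_word X (Y t) (l # s))) \<longlongrightarrow> 0) G"
          by (rule free) (use adj cent in auto)
        \<comment> \<open>The remaining factor may belong to the empty word, with trace 1, so only
          convergence can be claimed for it.\<close>
        have ex: "\<exists>c. ((\<lambda>t. \<tau> (eval_word X (Y t) s')) \<longlongrightarrow> c) G"
          if "distinct_adj (map fst s')" "\<forall>l\<in>set s'. centred \<alpha> \<beta> l" for s'
        proof (cases "s' = []")
          case True
          then show ?thesis by (intro exI[of _ 1]) simp
        next
          case False
          then show ?thesis by (intro exI[of _ 0] free that)
        qed
        obtain c where c: "((\<lambda>t. \<tau> (eval_word X (Y t) s)) \<longlongrightarrow> c) G"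
          using ex[of s] adj cent by auto
        obtain c' where c': "((\<lambda>t. \<tau> (eval_word X (Y t) r)) \<longlongrightarrow> c') G"
          using ex[of r] adj cent by auto
        have "((\<lambda>t. \<tau> (eval_word X (Y t) (r @ [l])) * \<tau> (eval_word X (Y t) s)
              - \<tau> (eval_word X (Y t) r) * \<tau> (eval_word X (Y t) (l # s))) \<longlongrightarrow> 0 * c - c' * 0) G"
          by (intro tendsto_diff tendsto_mult lim lim' c c')
        then have "((\<lambda>t. (if b then \<tau> (eval_word X (Y t) (r @ [l])) * \<tau> (eval_word X (Y t) s)
              - \<tau> (eval_word X (Y t) r) * \<tau> (eval_word X (Y t) (l # s)) else 0)
              + liberation \<tau> (eval_word X (Y t) (r @ [l])) (map (eval_letter X (Y t)) s) 1)
              \<longlongrightarrow> 0 + 0) G"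
          using Cons.IH[of "r @ [l]"] Cons.prems
          by (intro tendsto_add) (cases b, simp_all del: eval_word_simps)
        moreover have "liberation \<tau> (eval_word X (Y t) r) (map (eval_letter X (Y t)) (l # s)) 1 =
            (if b then \<tau> (eval_word X (Y t) (r @ [l])) * \<tau> (eval_word X (Y t) s)
              - \<tau> (eval_word X (Y t) r) * \<tau> (eval_word X (Y t) (l # s)) else 0)
              + liberation \<tau> (eval_word X (Y t) (r @ [l])) (map (eval_letter X (Y t)) s) 1" for t
        proof -
          have "eval_letter X (Y t) l = (b, snd (eval_letter X (Y t) l))"
            by (simp add: prod_eq_iff l)
          then show ?thesis
            using prod_list_eval_letter[of X "Y t" s]
              liberation.simps(2)[of \<tau> "eval_word X (Y t) r" b "snd (eval_letter X (Y t) l)"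
                "map (eval_letter X (Y t)) s" 1]
            by (simp add: mult.assoc del: liberation.simps map_map)
        qed
        ultimately show ?case
          by simp
      qed simp
      from this[of "[]" p] Nil show ?case
        by (simp add: L_def[abs_def])
    next
      case (Cons l q)
      obtain b c d where l: "l = (b, c, d)" by (rule prod_cases3)
      define m where "m = (if b then \<alpha> else \<beta>)"
      have "L (p @ l # q) = (\<lambda>t. (c + d * m) * L (p @ q) t + L (p @ (b, - d * m, d) # q) t)"
      proof
        fix t
        define Z where "Z = (if b then X else Y t)"
        have "c *\<^sub>C 1 + d *\<^sub>C Z = (c + d * m) *\<^sub>C 1 + ((- d * m) *\<^sub>C 1 + d *\<^sub>C Z)"
          by (simp add: scaleC_add_left scaleC_minus_left)
        moreover have "eval_letter X (Y t) (b, e, f) = (b, e *\<^sub>C 1 + f *\<^sub>C Z)" for e f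
          by (simp add: eval_letter_def Z_def)
        ultimately show "L (p @ l # q) t = (c + d * m) * L (p @ q) t + L (p @ (b, - d * m, d) # q) t"
          by (simp only: L_def l map_append list.map liberation_add_letter liberation_scalar_letter)
      qed
      moreover have "(L (p @ q) \<longlongrightarrow> 0) G"
        using Cons.prems by (intro IH) simp
      moreover have "(L (p @ (b, - d * m, d) # q) \<longlongrightarrow> 0) G"
        using Cons.IH[of "p @ [(b, - d * m, d)]"] Cons.prems
        by (simp add: l centred_def m_def)
      ultimately show ?case
        using tendsto_add[OF tendsto_mult_right_zero, of "L (p @ q)" G "L (p @ (b, - d * m, d) # q)" 0]
        by simp
    qed
    from this[of "[]" w] True show ?thesis by simp
  qed
  then show ?case by (simp add: L_def[abs_def])
qed

text \<open>
  Since \<open>U n\<close> and its centring differ by the scalar \<open>\<tau> (U n)\<close>, in the limit a centred word in \<open>R\<close>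
  and \<open>U n * S * star (U n)\<close> has the trace of a centred alternating word in the two free algebras.
\<close>

lemma asymptotically_free:
  fixes U :: "nat \<Rightarrow> 'a"
  assumes R: "symmetry R" and S: "symmetry S" and U: "\<And>n. unitary (U n)"
    and free: "freely_independent \<tau> A {R, S}" and UA: "\<And>n. U n \<in> A"
    and lim: "(\<lambda>n. \<tau> (U n)) \<longlonglongrightarrow> 0"
    and w: "w \<noteq> []" "distinct_adj (map fst w)" "\<forall>l\<in>set w. centred (\<tau> R) (\<tau> S) l"
  shows "(\<lambda>n. \<tau> (eval_word R (U n * S * star (U n)) w)) \<longlonglongrightarrow> 0"
proof -
  define V where "V n = U n * S * star (U n)" for n
  define u where "u n = \<tau> (U n) *\<^sub>C (1::'a)" for n
  \<comment> \<open>The marks change meaning: in w, \<open>True\<close> stands for R, whereas in the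
    flattened word \<open>True\<close> stands for the algebra of U and \<open>False\<close> for that
    of R and S. The scalar c disappears because in a centred letter it equals - d times the trace of
    the symmetry.\<close>
  define flat :: "nat \<Rightarrow> letter \<Rightarrow> (bool \<times> 'a) list" where
    "flat n = (\<lambda>(b, c, d). if b then [(False, d *\<^sub>C (R - \<tau> R *\<^sub>C 1))]
       else [(True, U n - u n), (False, d *\<^sub>C (S - \<tau> S *\<^sub>C 1)), (True, star (U n - u n))])" for n
  define flat_prod where "flat_prod n w = prod_list (map snd (concat (map (flat n) w)))" for n w
  have V: "symmetry (V n)" for n
    unfolding V_def by (rule symmetry_conj[OF U S])
  have norm_sym: "norm x = 1" if "symmetry x" for x :: 'a
    using that by (simp add: symmetry_def norm_unitary)

  have letter_bound: "norm (snd (eval_letter R (V n) (b, c, d))) \<le> cmod c + cmod d" for n b c d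
    using norm_triangle_ineq[of "c *\<^sub>C 1" "d *\<^sub>C (if b then R else V n)"]
    by (cases b) (simp_all add: eval_letter_def norm_scaleC norm_sym[OF R] norm_sym[OF V])
  have Bfun_letter: "Bfun (\<lambda>n. snd (eval_letter R (V n) l)) sequentially" for l
    by (cases l, rule BfunI[OF always_eventually]) (use letter_bound in blast)
  have Bfun_word: "Bfun (\<lambda>n. eval_word R (V n) w) sequentially" for w
  proof (induction w)
    case (Cons l w)
    obtain K where K: "eventually (\<lambda>n. norm (snd (eval_letter R (V n) l)) \<le> K) sequentially"
      using Bfun_letter[of l] by (auto elim: BfunE)
    obtain K' where K': "eventually (\<lambda>n. norm (eval_word R (V n) w) \<le> K') sequentially"
      using Cons.IH by (auto elim: BfunE)
    from K K' have "eventually (\<lambda>n. norm (eval_word R (V n) (l # w)) \<le> K * K') sequentially"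
    proof eventually_elim
      case (elim n)
      have "norm (eval_word R (V n) (l # w))
          \<le> norm (snd (eval_letter R (V n) l)) * norm (eval_word R (V n) w)"
        by (simp add: norm_mult_ineq)
      also have "\<dots> \<le> K * K'"
        using elim by (intro mult_mono) (auto intro: order_trans[OF norm_ge_zero])
      finally show ?case .
    qed
    then show ?case by (rule BfunI)
  qed (simp add: BfunI[of _ 1])

  have tendsto_mult_Bfun: "(\<lambda>n. x n * y n) \<longlonglongrightarrow> 0" "(\<lambda>n. y n * x n) \<longlonglongrightarrow> 0"
    if "x \<longlonglongrightarrow> 0" "Bfun y sequentially" for x y :: "nat \<Rightarrow> 'a"
    using bounded_bilinear.Zfun_prod_Bfun[OF bounded_bilinear_mult, of x sequentially y]
      bounded_bilinear.Bfun_prod_Zfun[OF bounded_bilinear_mult, of y sequentially x] that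
    by (simp_all add: tendsto_Zfun_iff)

  have "norm (u n) = cmod (\<tau> (U n))" "norm (star (u n)) = cmod (\<tau> (U n))" for n
    by (simp_all add: u_def star_scaleC norm_scaleC)
  then have u0: "u \<longlonglongrightarrow> 0" "(\<lambda>n. star (u n)) \<longlonglongrightarrow> 0"
    using tendsto_norm_zero[OF lim]
    by (simp_all add: tendsto_norm_zero_iff[of u, symmetric]
        tendsto_norm_zero_iff[of "\<lambda>n. star (u n)", symmetric])
  have BU: "Bfun U sequentially" "Bfun (\<lambda>n. star (U n)) sequentially"
    by (rule BfunI[of _ 1], simp add: norm_unitary U unitary_star)+
  have letter_lim: "(\<lambda>n. snd (eval_letter R (V n) l) - prod_list (map snd (flat n l))) \<longlonglongrightarrow> 0"
    if "centred (\<tau> R) (\<tau> S) l" for l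
  proof -
    obtain b c d where l: "l = (b, c, d)" by (rule prod_cases3)
    show ?thesis
    proof (cases b)
      case True
      with that have "c = - d * \<tau> R"
        by (simp add: l centred_def eq_neg_iff_add_eq_0)
      then show ?thesis
        using True by (simp add: l eval_letter_def flat_def scaleC_diff_right scaleC_scaleC
            scaleC_minus_left)
    next
      case False
      define S0 where "S0 = d *\<^sub>C (S - \<tau> S *\<^sub>C 1)"
      have "c = - d * \<tau> S"
        using that False by (simp add: l centred_def eq_neg_iff_add_eq_0)
      moreover have "U n * star (U n) = 1" for n
        using U by (simp add: unitary_def)
      ultimately have "snd (eval_letter R (V n) l) = U n * S0 * star (U n)" for n
        using False by (simp add: l eval_letter_def S0_def V_def scaleC_diff_right scaleC_scaleC
            scaleC_minus_left mult_scaleC_left mult_scaleC_right right_diff_distrib left_diff_distrib)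
      then have "snd (eval_letter R (V n) l) - prod_list (map snd (flat n l))
          = (u n * S0) * star (U n) + U n * (S0 * star (u n)) - (u n * S0) * star (u n)" for n
        using False by (simp add: l flat_def flip: S0_def) (simp add: star_diff algebra_simps)
      moreover have "(\<lambda>n. (u n * S0) * star (U n) + U n * (S0 * star (u n)) - (u n * S0) * star (u n))
          \<longlonglongrightarrow> 0 + 0 - 0 * 0"
        by (intro tendsto_add tendsto_diff tendsto_mult tendsto_mult_Bfun BU
            tendsto_mult_left_zero tendsto_mult_right_zero u0)
      ultimately show ?thesis by simp
    qed
  qed
  have word_lim: "(\<lambda>n. eval_word R (V n) w - flat_prod n w) \<longlonglongrightarrow> 0"
    if "\<forall>l\<in>set w. centred (\<tau> R) (\<tau> S) l" for w
    using that
  proof (induction w)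
    case (Cons l w)
    define f where "f n = snd (eval_letter R (V n) l)" for n
    define g where "g n = prod_list (map snd (flat n l))" for n
    \<comment> \<open>Boundedness has been shown for the original factors, so the difference of
      products is expanded around them; the last term is a product of two null sequences.\<close>
    have "(\<lambda>n. (f n - g n) * eval_word R (V n) w + f n * (eval_word R (V n) w - flat_prod n w)
        - (f n - g n) * (eval_word R (V n) w - flat_prod n w)) \<longlonglongrightarrow> 0 + 0 - 0 * 0"
      unfolding f_def g_def using Cons
      by (intro tendsto_add tendsto_diff tendsto_mult tendsto_mult_Bfun letter_lim Bfun_word
          Bfun_letter) auto
    moreover have "eval_word R (V n) (l # w) - flat_prod n (l # w)
        = (f n - g n) * eval_word R (V n) w + f n * (eval_word R (V n) w - flat_prod n w)
        - (f n - g n) * (eval_word R (V n) w - flat_prod n w)" for n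
      by (simp add: flat_prod_def f_def g_def) (simp add: algebra_simps)
    ultimately show ?case by simp
  qed (simp add: flat_prod_def)

  have "\<tau> (flat_prod n w) = 0" for n
  proof -
    \<comment> \<open>A block for R is \<open>False\<close> alone, and a block for V both starts and
      ends with \<open>True\<close>. The clause on the first mark is what lets consecutive blocks be
      joined in the induction.\<close>
    have "distinct_adj (map fst (concat (map (flat n) w))) \<and>
        (w \<noteq> [] \<longrightarrow> concat (map (flat n) w) \<noteq> [] \<and> fst (hd (concat (map (flat n) w))) = (\<not> fst (hd w)))"
      using w(2)
    proof (induction w)
      case (Cons l w)
      obtain b c d where l: "l = (b, c, d)" by (rule prod_cases3)
      from Cons.prems have "distinct_adj (map fst w)" "w \<noteq> [] \<longrightarrow> b \<noteq> fst (hd w)"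
        by (auto simp: l distinct_adj_Cons hd_map)
      with Cons.IH show ?case
        by (cases "w = []") (auto simp: l flat_def distinct_adj_append_iff distinct_adj_Cons hd_map)
    qed simp
    moreover have "x \<in> star_subalgebra hull (if b then A else {R, S}) \<and> \<tau> x = 0"
      if bx: "(b, x) \<in> set (concat (map (flat n) w))" for b x
    proof -
      let ?N = "\<lambda>b. star_subalgebra hull (if b then A else {R, S})"
      have N: "star_subalgebra (?N b)" for b
        by (rule star_subalgebra_hull)
      have "U n - u n \<in> ?N True" "R - \<tau> R *\<^sub>C 1 \<in> ?N False" "S - \<tau> S *\<^sub>C 1 \<in> ?N False"
        unfolding u_def using UA by (simp_all add: star_subalgebra_diff_scaleC[OF star_subalgebra_hull] hull_inc)
      then have "star (U n - u n) \<in> ?N True" "d *\<^sub>C (R - \<tau> R *\<^sub>C 1) \<in> ?N False"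
        "d *\<^sub>C (S - \<tau> S *\<^sub>C 1) \<in> ?N False" "U n - u n \<in> ?N True" for d
        using N[of True] N[of False] by (simp_all add: star_subalgebra_def)
      moreover have "\<tau> (U n - u n) = 0" "\<tau> (star (U n - u n)) = 0"
        by (simp_all add: \<tau>_star u_def)
      ultimately show ?thesis
        using bx by (auto simp: flat_def split: if_splits)
    qed
    ultimately show ?thesis
      using free w(1) unfolding freely_independent_def free_subalgebras_def flat_prod_def
      by (elim allE[of _ "concat (map (flat n) w)"]) auto
  qed
  then have "\<tau> (eval_word R (V n) w) = \<tau> (eval_word R (V n) w - flat_prod n w)" for n
    by simp
  moreover have "(\<lambda>n. \<tau> (eval_word R (V n) w - flat_prod n w)) \<longlonglongrightarrow> \<tau> 0"
    by (rule bounded_linear.tendsto[OF \<tau>_bounded_linear word_lim[OF w(3)]])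
  ultimately show ?thesis
    by (simp add: V_def)
qed

text \<open>A word of odd length is a palindrome, that is, its middle letter conjugated by a product
  of symmetries. The trace sees only that letter, which is x for even k and y for odd k. Each
  induction step strips x y on the left and y x on the right.\<close>

lemma \<tau>_alternating_odd:
  assumes "x * x = 1" "y * y = 1"
  shows "\<tau> ((x * y) ^ k * x) = (if even k then \<tau> x else \<tau> y)"
proof (induction k rule: nat_less_induct)
  case (1 k)
  consider "k = 0" | "k = 1" | j where "k = j + 2"
    by (metis One_nat_def add_2_eq_Suc' not0_implies_Suc)
  then show ?case
  proof cases
    case 2
    have "\<tau> (x * y * x) = \<tau> (x * x * y)"
      by (metis tracial mult.assoc)
    with 2 assms show ?thesis by simp
  next
    case 3
    have "y * (x * (x * y)) = 1"
      using assms by (simp flip: mult.assoc[of x x]) 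
    then have *: "y * x * (x * y) = 1"
      by (simp add: mult.assoc)
    have "(x * y) ^ k = x * y * ((x * y) ^ j * (x * y))"
      by (simp add: 3 power_commutes)
    then have "(x * y) ^ k * x = x * y * ((x * y) ^ j * x) * (y * x)"
      by (simp only: mult.assoc)
    then have "\<tau> ((x * y) ^ k * x) = \<tau> (((x * y) ^ j * x) * (y * x * (x * y)))"
      by (metis tracial mult.assoc)
    with 3 1 show ?thesis
      by (simp add: *)
  qed simp
qed

text \<open>Applied to (R V)^n, the gradient sets products of traces of odd pieces against products
  of traces of even pieces. The odd ones are the trace of R or of S at every time, by traciality;
  the even ones are moments of R V.\<close>

lemma free_symmetries_moment_recursion:
  fixes U :: "nat \<Rightarrow> 'a"
  assumes R: "symmetry R" and S: "symmetry S" and U: "\<And>n. unitary (U n)"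
    and free: "freely_independent \<tau> A {R, S}" and UA: "\<And>n. U n \<in> A"
    and lim: "(\<lambda>n. \<tau> (U n)) \<longlonglongrightarrow> 0"
    and M: "\<And>k. (\<lambda>n. \<tau> ((R * U n * S * star (U n)) ^ k)) \<longlonglongrightarrow> M k"
  shows "(\<Sum>k<n. M k * M (n - k)) =
    (\<Sum>k<n. (if even k then \<tau> R else \<tau> S) * (if even (n - 1 - k) then \<tau> S else \<tau> R))"
proof -
  define V where "V n = U n * S * star (U n)" for n
  have RR: "R * R = 1" and VV: "V m * V m = 1" for m
    using symmetry_square[OF R] symmetry_square[OF symmetry_conj[OF U S]] by (simp_all add: V_def)
  have \<tau>V: "\<tau> (V m) = \<tau> S" for m
    unfolding V_def by (rule \<tau>_conj[OF U])
  define w :: "letter list" where "w = concat (replicate n [(True, 0, 1), (False, 0, 1)])"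
  have map_w: "map (eval_letter R (V m)) w = concat (replicate n [(True, R), (False, V m)])" for m
    unfolding w_def by (induction n) (simp_all add: eval_letter_def)
  have "(\<lambda>m. liberation \<tau> 1 (map (eval_letter R (V m)) w) 1) \<longlonglongrightarrow> 0"
    by (rule liberation_tendsto_0[OF RR VV, of "\<tau> R" "\<tau> S"])
      (use asymptotically_free[OF R S U free UA lim] in \<open>simp add: V_def\<close>)
  moreover have "\<tau> ((R * V m) ^ k * R) = (if even k then \<tau> R else \<tau> S)"
    "\<tau> (V m * (R * V m) ^ k) = (if even k then \<tau> S else \<tau> R)" for m k
  proof -
    show "\<tau> ((R * V m) ^ k * R) = (if even k then \<tau> R else \<tau> S)"
      using \<tau>_alternating_odd[OF RR VV, of m k] by (simp add: \<tau>V)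
    have "V m * (R * V m) ^ k = (V m * R) ^ k * V m"
      by (induction k) (simp_all add: mult.assoc power_commutes)
    then show "\<tau> (V m * (R * V m) ^ k) = (if even k then \<tau> S else \<tau> R)"
      using \<tau>_alternating_odd[OF VV RR, of m k] by (simp add: \<tau>V)
  qed
  ultimately have "(\<lambda>m. \<Sum>k<n. (if even k then \<tau> R else \<tau> S) * (if even (n - 1 - k) then \<tau> S else \<tau> R)
      - \<tau> ((R * V m) ^ k) * \<tau> ((R * V m) ^ (n - k))) \<longlonglongrightarrow> 0"
    by (simp only: map_w liberation_alternating mult_1_left mult_1_right)
  moreover have "(\<lambda>m. \<Sum>k<n. (if even k then \<tau> R else \<tau> S) * (if even (n - 1 - k) then \<tau> S else \<tau> R)
      - \<tau> ((R * V m) ^ k) * \<tau> ((R * V m) ^ (n - k))) \<longlonglongrightarrow>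
      (\<Sum>k<n. (if even k then \<tau> R else \<tau> S) * (if even (n - 1 - k) then \<tau> S else \<tau> R) - M k * M (n - k))"
    using M by (intro tendsto_sum tendsto_diff tendsto_mult tendsto_const) (simp_all add: V_def mult.assoc)
  ultimately have "(\<Sum>k<n. (if even k then \<tau> R else \<tau> S) * (if even (n - 1 - k) then \<tau> S else \<tau> R)
      - M k * M (n - k)) = 0"
    using LIMSEQ_unique by blast
  then show ?thesis
    by (simp only: sum_subtractf right_minus_eq)
qed

end

section \<open>Herglotz transforms of measures on the unit circle\<close>

text \<open>The kernel is (1 + w) / (1 - w), with real part (1 - |w|^2) / |1 - w|^2, the Poisson
  kernel.\<close>

lemma Re_herglotz_kernel_nonneg:
  assumes "cmod w < 1"
  shows "0 \<le> Re (2 / (1 - w) - 1)"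
proof -
  have "(Re w)\<^sup>2 + (Im w)\<^sup>2 < 1"
    using assms by (simp add: cmod_def)
  moreover from this have "(1 - Re w)\<^sup>2 + (Im w)\<^sup>2 > 0"
  proof -
    have "Re w \<noteq> 1" using \<open>(Re w)\<^sup>2 + (Im w)\<^sup>2 < 1\<close> by (auto simp: not_less)
    then show ?thesis by (simp add: sum_power2_gt_zero_iff)
  qed
  moreover have "2 * (1 - Re w) - ((1 - Re w)\<^sup>2 + (Im w)\<^sup>2) = 1 - ((Re w)\<^sup>2 + (Im w)\<^sup>2)"
    by (simp add: power2_eq_square algebra_simps)
  ultimately show ?thesis
    by (simp add: Re_divide field_simps)
qed

text \<open>|w^2| + Re (w^2) = 2 (Re w)^2. This takes the place of choosing a branch of the square
  root.\<close>

lemma Re_eq_sqrt: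
  assumes "w\<^sup>2 = W" "0 \<le> Re w"
  shows "Re w = sqrt ((cmod W + Re W) / 2)"
proof -
  have "cmod W = (Re w)\<^sup>2 + (Im w)\<^sup>2" "Re W = (Re w)\<^sup>2 - (Im w)\<^sup>2"
    using assms(1) by (auto simp: norm_power cmod_power2 Re_power2 simp flip: assms(1))
  then have "(cmod W + Re W) / 2 = (Re w)\<^sup>2" by simp
  with assms(2) show ?thesis by simp
qed

text \<open>The radicand of the Herglotz transform: (\<alpha> + \<beta> z) (\<beta> + \<alpha> z) =
  \<alpha> \<beta> (1 + z)^2 + (\<alpha> - \<beta>)^2 z. The factored form is the one produced by
  multiplying two power series with alternating coefficients.\<close>

definition herglotz_square :: "real \<Rightarrow> real \<Rightarrow> complex \<Rightarrow> complex" where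
  "herglotz_square \<alpha> \<beta> z = 1 + 4 * z * (\<alpha> + \<beta> * z) * (\<beta> + \<alpha> * z) / (1 - z\<^sup>2)\<^sup>2"

definition herglotz_re :: "real \<Rightarrow> real \<Rightarrow> complex \<Rightarrow> real" where
  "herglotz_re \<alpha> \<beta> z = sqrt ((cmod (herglotz_square \<alpha> \<beta> z) + Re (herglotz_square \<alpha> \<beta> z)) / 2)"

lemma herglotz_re_nonneg: "0 \<le> herglotz_re \<alpha> \<beta> z"
proof -
  have "0 \<le> cmod w + Re w" for w
    using abs_Re_le_cmod[of w] by linarith
  then show ?thesis by (simp add: herglotz_re_def)
qed

lemma herglotz_re_cnj: "herglotz_re \<alpha> \<beta> (cnj z) = herglotz_re \<alpha> \<beta> z"
proof -
  have "herglotz_square \<alpha> \<beta> (cnj z) = cnj (herglotz_square \<alpha> \<beta> z)"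
    by (simp add: herglotz_square_def)
  then show ?thesis by (simp add: herglotz_re_def)
qed

lemma measurable_herglotz_re [measurable]: "herglotz_re \<alpha> \<beta> \<in> borel_measurable borel"
  unfolding herglotz_re_def[abs_def] herglotz_square_def[abs_def] by measurable

text \<open>Away from the zeros of 1 - z^2 the formula is a composition of continuous functions
  without a branch cut, so the statement covers the rest of the unit circle as well as the
  disc.\<close>

lemma tendsto_herglotz_re:
  assumes "(f \<longlongrightarrow> z) F" "z\<^sup>2 \<noteq> 1"
  shows "((\<lambda>x. herglotz_re \<alpha> \<beta> (f x)) \<longlongrightarrow> herglotz_re \<alpha> \<beta> z) F"
  unfolding herglotz_re_def herglotz_square_def using assms
  by (intro tendsto_intros) auto

section \<open>Moments and the Cauchy transform of a measure on the circle\<close>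

locale circle_measure = prob_space \<nu> for \<nu> :: "complex measure" +
  assumes sets_borel [measurable_cong, simp]: "sets \<nu> = sets borel"
    and AE_circle: "AE z in \<nu>. cmod z = 1"
begin

lemma integrable_circle:
  fixes f :: "complex \<Rightarrow> 'b::{banach, second_countable_topology}"
  assumes "f \<in> borel_measurable borel" "\<And>z. cmod z = 1 \<Longrightarrow> norm (f z) \<le> B"
  shows "integrable \<nu> f"
  using assms AE_circle by (intro integrable_const_bound[of _ B]) (auto elim!: eventually_mono)

definition moment :: "nat \<Rightarrow> complex" where
  "moment n = (\<integral>z. z ^ n \<partial>\<nu>)"

lemma moment_0 [simp]: "moment 0 = 1"
  by (simp add: moment_def prob_space)

lemma norm_moment_le: "cmod (moment n) \<le> 1"
proof -
  have "cmod (moment n) \<le> (\<integral>z. cmod (z ^ n) \<partial>\<nu>)"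
    unfolding moment_def by (rule integral_norm_bound)
  also have "\<dots> = (\<integral>z. 1 \<partial>\<nu>)"
    using AE_circle by (intro integral_cong_AE) (auto simp: norm_power elim!: eventually_mono)
  finally show ?thesis by (simp add: prob_space)
qed

text \<open>The kernel pairs z with \<zeta> and not with its conjugate, which makes this the
  generating function of the moments. Then \<open>2 * cauchy_transform z - 1\<close> is the
  conjugate of the Herglotz transform at \<open>cnj z\<close>.\<close>

definition cauchy_transform :: "complex \<Rightarrow> complex" where
  "cauchy_transform z = (\<integral>\<zeta>. 1 / (1 - z * \<zeta>) \<partial>\<nu>)"

lemma cauchy_kernel_bound:
  assumes "cmod z < 1" "cmod \<zeta> = 1"
  shows "cmod (1 / (1 - z * \<zeta>)) \<le> 1 / (1 - cmod z)"
proof -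
  have "1 - cmod z \<le> cmod (1 - z * \<zeta>)"
    using norm_triangle_ineq2[of 1 "z * \<zeta>"] assms by (simp add: norm_mult)
  with assms show ?thesis
    by (simp add: norm_divide frac_le)
qed

lemma integrable_cauchy_kernel:
  assumes "cmod z < 1"
  shows "integrable \<nu> (\<lambda>\<zeta>. 1 / (1 - z * \<zeta>))"
  by (rule integrable_circle[OF _ cauchy_kernel_bound[OF assms]]) measurable

lemma moment_sums:
  assumes "cmod z < 1"
  shows "(\<lambda>n. moment n * z ^ n) sums cauchy_transform z"
proof -
  let ?f = "\<lambda>n \<zeta>. (z * \<zeta>) ^ n"
  have int: "integrable \<nu> (?f n)" for n
    by (rule integrable_circle[of _ "cmod z ^ n"]) (auto simp: norm_mult norm_power power_mult_distrib)
  have norm: "(\<integral>\<zeta>. norm (?f n \<zeta>) \<partial>\<nu>) = cmod z ^ n" for n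
  proof -
    have "(\<integral>\<zeta>. norm (?f n \<zeta>) \<partial>\<nu>) = (\<integral>\<zeta>. cmod z ^ n \<partial>\<nu>)"
      using AE_circle by (intro integral_cong_AE) (auto simp: norm_power norm_mult elim!: eventually_mono)
    then show ?thesis by (simp add: prob_space)
  qed
  have "(\<lambda>n. integral\<^sup>L \<nu> (?f n)) sums (\<integral>\<zeta>. (\<Sum>n. ?f n \<zeta>) \<partial>\<nu>)"
  proof (rule sums_integral[OF int])
    show "AE \<zeta> in \<nu>. summable (\<lambda>n. norm (?f n \<zeta>))"
      using AE_circle assms by (auto simp: norm_power norm_mult summable_geometric elim!: eventually_mono)
    show "summable (\<lambda>n. \<integral>\<zeta>. norm (?f n \<zeta>) \<partial>\<nu>)"
      using assms by (simp add: norm summable_geometric)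
  qed
  moreover have "(\<integral>\<zeta>. (\<Sum>n. ?f n \<zeta>) \<partial>\<nu>) = cauchy_transform z"
    unfolding cauchy_transform_def using AE_circle assms
    by (intro integral_cong_AE) (auto simp: suminf_geometric norm_mult elim!: eventually_mono)
  moreover have "integral\<^sup>L \<nu> (?f n) = moment n * z ^ n" for n
    by (simp add: power_mult_distrib moment_def mult.commute)
  ultimately show ?thesis by simp
qed

lemma summable_norm_moment:
  assumes "cmod z < 1"
  shows "summable (\<lambda>n. norm (moment n * z ^ n))"
proof (rule summable_comparison_test[OF _ summable_geometric[of "cmod z"]])
  show "\<exists>N. \<forall>n\<ge>N. norm (norm (moment n * z ^ n)) \<le> cmod z ^ n"
    using mult_right_mono[OF norm_moment_le] by (simp add: norm_mult norm_power)
qed (use assms in auto)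

lemma Re_cauchy_transform:
  assumes "cmod z < 1"
  shows "0 \<le> Re (2 * cauchy_transform z - 1)"
proof -
  have "(\<integral>\<zeta>. 2 * (1 / (1 - z * \<zeta>)) - 1 \<partial>\<nu>) = (\<integral>\<zeta>. 2 * (1 / (1 - z * \<zeta>)) \<partial>\<nu>) - (\<integral>\<zeta>. 1 \<partial>\<nu>)"
    by (intro Bochner_Integration.integral_diff integrable_mult_right integrable_cauchy_kernel assms) simp
  also have "\<dots> = 2 * cauchy_transform z - 1"
    by (simp only: integral_mult_right_zero cauchy_transform_def) (simp add: prob_space)
  finally have "2 * cauchy_transform z - 1 = (\<integral>\<zeta>. 2 * (1 / (1 - z * \<zeta>)) - 1 \<partial>\<nu>)" ..
  also have "Re \<dots> = (\<integral>\<zeta>. Re (2 * (1 / (1 - z * \<zeta>)) - 1) \<partial>\<nu>)"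
    by (intro integral_Re[symmetric] Bochner_Integration.integrable_diff integrable_mult_right
        integrable_cauchy_kernel assms) simp
  also have "\<dots> \<ge> 0"
    using AE_circle
    by (intro integral_nonneg_AE, elim eventually_mono)
      (use Re_herglotz_kernel_nonneg assms in \<open>simp add: norm_mult\<close>)
  finally show ?thesis .
qed

end

text \<open>The sequence c, d, c, d, ... is (c + d) / 2 + (c - d) / 2 * (-1)^k, so its generating
  function is a sum of two geometric series.\<close>

lemma alternating_sums:
  fixes z c d :: complex
  assumes "cmod z < 1"
  shows "(\<lambda>k. (if even k then c else d) * z ^ k) sums ((c + d * z) / (1 - z\<^sup>2))"
    and "summable (\<lambda>k. norm ((if even k then c else d) * z ^ k))"
proof -
  have ne: "1 - z \<noteq> 0" "1 + z \<noteq> 0"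
    using assms by (auto simp: add_eq_0_iff)
  have "(\<lambda>k. (c + d) / 2 * z ^ k + (c - d) / 2 * (- z) ^ k) sums
      ((c + d) / 2 * (1 / (1 - z)) + (c - d) / 2 * (1 / (1 - (- z))))"
    using assms by (intro sums_add sums_mult geometric_sums) auto
  moreover have "(c + d) / 2 * z ^ k + (c - d) / 2 * (- z) ^ k = (if even k then c else d) * z ^ k" for k
    by (auto simp: field_simps)
  moreover have "(c + d) / 2 * (1 / (1 - z)) + (c - d) / 2 * (1 / (1 - (- z))) = (c + d * z) / (1 - z\<^sup>2)"
  proof -
    have A: "1 - z\<^sup>2 = (1 - z) * (1 + z)"
      by (simp add: power2_eq_square algebra_simps)
    have B: "(c + d) / 2 * (1 / x) + (c - d) / 2 * (1 / y) = ((c + d) * y + (c - d) * x) / 2 / (x * y)"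
      if "x \<noteq> 0" "y \<noteq> 0" for x y
      using that by (simp add: field_simps)
    have C: "((c + d) * (1 + z) + (c - d) * (1 - z)) / 2 = c + d * z"
      by (simp add: field_simps)
    show ?thesis
      by (simp only: A B[OF ne] C minus_minus diff_minus_eq_add)
  qed
  ultimately show "(\<lambda>k. (if even k then c else d) * z ^ k) sums ((c + d * z) / (1 - z\<^sup>2))"
    by simp
  show "summable (\<lambda>k. norm ((if even k then c else d) * z ^ k))"
  proof (rule summable_comparison_test)
    show "summable (\<lambda>k. (cmod c + cmod d) * cmod z ^ k)"
      using assms by (intro summable_mult summable_geometric) simp
    show "\<exists>N. \<forall>n\<ge>N. norm (norm ((if even n then c else d) * z ^ n)) \<le> (cmod c + cmod d) * cmod z ^ n"
      by (auto simp: norm_mult norm_power intro!: mult_right_mono)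
  qed
qed

text \<open>From here on, freeness enters only through this recursion. The index k = 0 on the left
  contributes \<open>moment n\<close>, and the other indices involve lower moments, so all moments
  are determined.\<close>

locale free_symmetries_law = circle_measure \<nu> for \<nu> +
  fixes \<alpha> \<beta> :: real
  assumes moment_recursion: "(\<Sum>k<n. moment k * moment (n - k)) =
    (\<Sum>k<n. (if even k then complex_of_real \<alpha> else \<beta>) *
      (if even (n - 1 - k) then complex_of_real \<beta> else \<alpha>))"
begin

lemma cauchy_transform_quadratic:
  fixes z :: complex
  assumes z: "cmod z < 1"
  shows "cauchy_transform z * (cauchy_transform z - 1)
    = z * (\<alpha> + \<beta> * z) * (\<beta> + \<alpha> * z) / (1 - z\<^sup>2)\<^sup>2"
proof -
  define p q where "p k = (if even k then complex_of_real \<alpha> else \<beta>)"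
    and "q k = (if even k then complex_of_real \<beta> else \<alpha>)" for k :: nat
  \<comment> \<open>The sum over k < n stops before \<open>moment n * moment 0\<close>. Deleting the
    constant term of the second factor has the same effect, whence the product \<psi> (\<psi> -
    1).\<close>
  define f g where "f n = moment n * z ^ n" and "g n = f n - (if n = 0 then 1 else 0)" for n
  have f: "summable (\<lambda>n. norm (f n))" "f sums cauchy_transform z"
    unfolding f_def[abs_def] using summable_norm_moment moment_sums z by auto
  have "(\<lambda>n. if n = 0 then 1 else (0 :: complex)) sums 1"
    using sums_single[of 0 "\<lambda>_. 1 :: complex"] by simp
  then have g_sums: "g sums (cauchy_transform z - 1)"
    unfolding g_def[abs_def] by (rule sums_diff[OF f(2)])
  have g: "summable (\<lambda>n. norm (g n))"
    by (rule summable_comparison_test[OF _ f(1)]) (auto simp: g_def intro!: exI[of _ 1])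
  have "(\<lambda>n. \<Sum>i\<le>n. f i * g (n - i)) sums (cauchy_transform z * (cauchy_transform z - 1))"
    using Cauchy_product_sums[OF f(1) g] f(2) g_sums by (simp add: sums_unique[symmetric])
  moreover have "(\<Sum>i\<le>n. f i * g (n - i)) = z ^ n * (\<Sum>k<n. p k * q (n - 1 - k))" for n
  proof -
    have "(\<Sum>i\<le>n. f i * g (n - i)) = (\<Sum>i<n. f i * g (n - i))"
      by (simp add: lessThan_Suc_atMost[symmetric] g_def f_def)
    also have "\<dots> = (\<Sum>i<n. z ^ n * (moment i * moment (n - i)))"
      by (intro sum.cong refl) (auto simp: f_def g_def mult_ac simp flip: power_add)
    also have "\<dots> = z ^ n * (\<Sum>k<n. p k * q (n - 1 - k))"
      by (simp add: sum_distrib_left[symmetric] moment_recursion p_def q_def)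
    finally show ?thesis .
  qed
  ultimately have "(\<lambda>n. z ^ n * (\<Sum>k<n. p k * q (n - 1 - k))) sums
      (cauchy_transform z * (cauchy_transform z - 1))"
    by simp
  moreover have "(\<lambda>n. z ^ n * (\<Sum>k<n. p k * q (n - 1 - k))) sums
      (z * ((\<alpha> + \<beta> * z) / (1 - z\<^sup>2) * ((\<beta> + \<alpha> * z) / (1 - z\<^sup>2))))"
  proof -
    have p: "(\<lambda>k. p k * z ^ k) sums ((\<alpha> + \<beta> * z) / (1 - z\<^sup>2))" "summable (\<lambda>k. norm (p k * z ^ k))"
      and q: "(\<lambda>k. q k * z ^ k) sums ((\<beta> + \<alpha> * z) / (1 - z\<^sup>2))" "summable (\<lambda>k. norm (q k * z ^ k))"
      unfolding p_def q_def using alternating_sums[OF z] by auto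
    have "(\<lambda>n. \<Sum>i\<le>n. p i * z ^ i * (q (n - i) * z ^ (n - i))) sums
        ((\<alpha> + \<beta> * z) / (1 - z\<^sup>2) * ((\<beta> + \<alpha> * z) / (1 - z\<^sup>2)))"
      using Cauchy_product_sums[OF p(2) q(2)] p(1) q(1) by (simp add: sums_unique[symmetric])
    then have "(\<lambda>n. z * (\<Sum>i\<le>n. p i * z ^ i * (q (n - i) * z ^ (n - i)))) sums
        (z * ((\<alpha> + \<beta> * z) / (1 - z\<^sup>2) * ((\<beta> + \<alpha> * z) / (1 - z\<^sup>2))))"
      by (rule sums_mult)
    \<comment> \<open>The indices of p and q add up to one less than the exponent of z; this shift
      is the extra factor z. At exponent 0 the sum is empty, so \<open>sums_Suc\<close> adds only
      0.\<close>
    moreover have "z * (\<Sum>i\<le>n. p i * z ^ i * (q (n - i) * z ^ (n - i)))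
        = z ^ Suc n * (\<Sum>k<Suc n. p k * q (Suc n - 1 - k))" for n
      unfolding lessThan_Suc_atMost sum_distrib_left
      by (intro sum.cong refl) (auto simp: mult_ac simp flip: power_add)
    ultimately have "(\<lambda>n. z ^ Suc n * (\<Sum>k<Suc n. p k * q (Suc n - 1 - k))) sums
        (z * ((\<alpha> + \<beta> * z) / (1 - z\<^sup>2) * ((\<beta> + \<alpha> * z) / (1 - z\<^sup>2))))"
      by (simp only:)
    from sums_Suc[OF this] show ?thesis by simp
  qed
  ultimately have "cauchy_transform z * (cauchy_transform z - 1)
      = z * ((\<alpha> + \<beta> * z) / (1 - z\<^sup>2) * ((\<beta> + \<alpha> * z) / (1 - z\<^sup>2)))"
    by (rule sums_unique2)
  then show ?thesis
    by (simp add: power2_eq_square mult.assoc)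
qed

lemma Re_herglotz:
  assumes "cmod z < 1"
  shows "Re (2 * cauchy_transform z - 1) = herglotz_re \<alpha> \<beta> z"
  unfolding herglotz_re_def
proof (rule Re_eq_sqrt[OF _ Re_cauchy_transform[OF assms]])
  have "(2 * cauchy_transform z - 1)\<^sup>2 = 1 + 4 * (cauchy_transform z * (cauchy_transform z - 1))"
    by (simp add: power2_eq_square algebra_simps)
  then show "(2 * cauchy_transform z - 1)\<^sup>2 = herglotz_square \<alpha> \<beta> z"
    by (simp add: cauchy_transform_quadratic[OF assms] herglotz_square_def mult.assoc)
qed

text \<open>As \<epsilon> is its own inverse, (1 - r) / (1 - r \<epsilon> \<zeta>) is 1 at \<zeta> =
  \<epsilon> and tends to 0 at every other point of the circle. It is bounded by 1, so dominated
  convergence isolates the point mass.\<close>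

lemma atom_limit:
  assumes \<epsilon>: "\<epsilon> = 1 \<or> \<epsilon> = - 1" and r: "\<And>n. 0 \<le> r n" "\<And>n. r n < 1" "r \<longlonglongrightarrow> (1::real)"
  shows "(\<lambda>n. of_real (1 - r n) * cauchy_transform (of_real (r n) * of_real \<epsilon>))
    \<longlonglongrightarrow> of_real (measure \<nu> {of_real \<epsilon>})"
proof -
  let ?k = "\<lambda>n \<zeta>. of_real (1 - r n) * (1 / (1 - of_real (r n) * of_real \<epsilon> * \<zeta>)) :: complex"
  have "(\<lambda>n. integral\<^sup>L \<nu> (?k n)) \<longlonglongrightarrow> (\<integral>\<zeta>. complex_of_real (indicator {of_real \<epsilon>} \<zeta>) \<partial>\<nu>)"
  proof (rule integral_dominated_convergence[where w = "\<lambda>_. 1"])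
    show "AE \<zeta> in \<nu>. (\<lambda>n. ?k n \<zeta>) \<longlonglongrightarrow> complex_of_real (indicator {of_real \<epsilon>} \<zeta>)"
      using AE_circle
    proof eventually_elim
      case (elim \<zeta>)
      show ?case
      proof (cases "\<zeta> = of_real \<epsilon>")
        case True
        have "of_real \<epsilon> * of_real \<epsilon> = (1 :: complex)"
          using \<epsilon> by auto
        then have "?k n \<zeta> = 1" for n
          using r(2)[of n] by (simp add: True mult.assoc)
        then have "(\<lambda>n. ?k n \<zeta>) = (\<lambda>n. 1)"
          by (rule ext)
        then show ?thesis
          by (simp only:) (simp add: True)
      next
        case False
        have "1 - 1 * of_real \<epsilon> * \<zeta> \<noteq> 0"
        proof
          assume "1 - 1 * of_real \<epsilon> * \<zeta> = 0"
          then have "of_real \<epsilon> * (of_real \<epsilon> * \<zeta>) = of_real \<epsilon>"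
            by simp
          moreover have "of_real \<epsilon> * (of_real \<epsilon> * \<zeta>) = \<zeta>"
            using \<epsilon> by auto
          ultimately show False using False by simp
        qed
        then have "(\<lambda>n. ?k n \<zeta>) \<longlonglongrightarrow> of_real (1 - 1) * (1 / (1 - of_real 1 * of_real \<epsilon> * \<zeta>))"
          by (intro tendsto_intros r(3)) auto
        with False show ?thesis by simp
      qed
    qed
    show "AE \<zeta> in \<nu>. norm (?k n \<zeta>) \<le> 1" for n
      using AE_circle
    proof eventually_elim
      case (elim \<zeta>)
      have "cmod (of_real (r n) * of_real \<epsilon>) = r n"
        using \<epsilon> r(1)[of n] by (auto simp: norm_mult)
      then have "norm (?k n \<zeta>) \<le> (1 - r n) * (1 / (1 - r n))"
        using cauchy_kernel_bound[of "of_real (r n) * of_real \<epsilon>" \<zeta>] elim r(2)[of n]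
        unfolding norm_mult by (intro mult_mono) (auto simp: norm_of_real simp del: of_real_diff)
      then show ?case using r(2)[of n] by simp
    qed
  qed (auto intro: integrable_const)
  moreover have "integral\<^sup>L \<nu> (?k n) = of_real (1 - r n) * cauchy_transform (of_real (r n) * of_real \<epsilon>)" for n
    by (simp only: integral_mult_right_zero cauchy_transform_def)
  moreover have "space \<nu> = UNIV"
    using sets_eq_imp_space_eq[OF sets_borel] by simp
  ultimately show ?thesis
    by (simp only: integral_complex_of_real integral_indicator) simp
qed

lemma measure_atom:
  assumes \<epsilon>: "\<epsilon> = 1 \<or> \<epsilon> = - 1"
  shows "measure \<nu> {of_real \<epsilon>} = \<bar>\<alpha> + \<epsilon> * \<beta>\<bar> / 2"
proof -
  define r where "r n = 1 - inverse (real (Suc n))" for n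
  have r: "0 \<le> r n" "r n < 1" for n
    by (simp_all add: r_def field_simps)
  have lim: "r \<longlonglongrightarrow> 1"
    unfolding r_def[abs_def] using tendsto_diff[OF tendsto_const LIMSEQ_inverse_real_of_nat, of 1] by simp
  let ?z = "\<lambda>n. of_real (r n) * of_real \<epsilon> :: complex"
  have z: "cmod (?z n) < 1" "(?z n)\<^sup>2 = of_real ((r n)\<^sup>2)" for n
    using \<epsilon> r[of n] by (auto simp: norm_mult power_mult_distrib)
  \<comment> \<open>(1 - r)^2 H^2 at the point r \<epsilon>, with the pole cancelled: there (1 -
    z^2)^2 = (1 - r)^2 (1 + r)^2. In this form the limit can be taken.\<close>
  define W where "W n = of_real ((1 - r n)\<^sup>2)
      + 4 * ?z n * (\<alpha> + \<beta> * ?z n) * (\<beta> + \<alpha> * ?z n) / of_real ((1 + r n)\<^sup>2)" for n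
  have eq: "Re (of_real (1 - r n) * cauchy_transform (?z n))
      = (1 - r n) / 2 + sqrt ((cmod (W n) + Re (W n)) / 2) / 2" for n
  proof -
    have ne: "1 - r n \<noteq> 0" "1 + r n \<noteq> 0" using r[of n] by auto
    have W: "W n = of_real ((1 - r n)\<^sup>2) * herglotz_square \<alpha> \<beta> (?z n)"
    proof -
      have "1 - (?z n)\<^sup>2 = of_real (1 - (r n)\<^sup>2)"
        unfolding z(2) by simp
      also have "1 - (r n)\<^sup>2 = (1 - r n) * (1 + r n)"
        by (simp add: power2_eq_square algebra_simps)
      finally have sq: "(1 - (?z n)\<^sup>2)\<^sup>2 = of_real ((1 - r n)\<^sup>2) * of_real ((1 + r n)\<^sup>2)"
        by (simp only: power_mult_distrib of_real_mult of_real_power)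
      have "x + N / y = x * (1 + N / (x * y))" if "x \<noteq> 0" "y \<noteq> 0" for x y N :: complex
        using that by (simp add: field_simps)
      then show ?thesis
        unfolding W_def herglotz_square_def sq using ne by (metis of_real_eq_0_iff power_not_zero)
    qed
    have "Re (W n) = (1 - r n)\<^sup>2 * Re (herglotz_square \<alpha> \<beta> (?z n))"
      and "cmod (W n) = (1 - r n)\<^sup>2 * cmod (herglotz_square \<alpha> \<beta> (?z n))"
      unfolding W by (simp_all add: norm_mult norm_of_real del: of_real_power of_real_diff)
    then have "(cmod (W n) + Re (W n)) / 2 = (1 - r n)\<^sup>2 *
        ((cmod (herglotz_square \<alpha> \<beta> (?z n)) + Re (herglotz_square \<alpha> \<beta> (?z n))) / 2)"
      by (simp add: distrib_left)
    then have "sqrt ((cmod (W n) + Re (W n)) / 2) = (1 - r n) * herglotz_re \<alpha> \<beta> (?z n)"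
      using r[of n] by (simp only: herglotz_re_def real_sqrt_mult real_sqrt_abs)
    moreover have "Re (of_real (1 - r n) * cauchy_transform (?z n)) = (1 - r n) * Re (cauchy_transform (?z n))"
      by (simp del: of_real_diff)
    moreover have "Re (cauchy_transform (?z n)) = (1 + herglotz_re \<alpha> \<beta> (?z n)) / 2"
      using Re_herglotz[OF z(1), of n] by simp
    ultimately show ?thesis
      by (simp only:) (simp add: field_simps)
  qed
  have "(\<lambda>n. Re (of_real (1 - r n) * cauchy_transform (?z n))) \<longlonglongrightarrow> Re (of_real (measure \<nu> {of_real \<epsilon>}))"
    by (intro tendsto_Re atom_limit[OF \<epsilon> r lim])
  moreover have "(\<lambda>n. Re (of_real (1 - r n) * cauchy_transform (?z n))) \<longlonglongrightarrow> \<bar>\<alpha> + \<epsilon> * \<beta>\<bar> / 2"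
  proof -
    define z where "z = complex_of_real 1 * of_real \<epsilon>"
    define L where "L = complex_of_real ((1 - 1)\<^sup>2)
      + 4 * z * (complex_of_real \<alpha> + \<beta> * z) * (complex_of_real \<beta> + \<alpha> * z) / of_real ((1 + 1)\<^sup>2)"
    have "W \<longlonglongrightarrow> L"
      unfolding W_def[abs_def] L_def z_def by (intro tendsto_intros lim) simp
    then have "(\<lambda>n. (1 - r n) / 2 + sqrt ((cmod (W n) + Re (W n)) / 2) / 2)
        \<longlonglongrightarrow> (1 - 1) / 2 + sqrt ((cmod L + Re L) / 2) / 2"
      by (intro tendsto_intros lim) simp_all
    \<comment> \<open>From \<epsilon>^2 = 1 follows \<epsilon> (\<beta> + \<alpha> \<epsilon>) =
      \<alpha> + \<epsilon> \<beta>, so the two linear factors become a square and the root in the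
      limit is an absolute value.\<close>
    moreover have "L = of_real ((\<alpha> + \<epsilon> * \<beta>)\<^sup>2)"
      using \<epsilon> by (auto simp: L_def z_def power2_eq_square algebra_simps)
    then have "(cmod L + Re L) / 2 = (\<alpha> + \<epsilon> * \<beta>)\<^sup>2"
      by (simp add: norm_of_real del: of_real_power of_real_add of_real_mult)
    ultimately show ?thesis
      by (simp only: eq) simp
  qed
  ultimately show ?thesis
    using LIMSEQ_unique by fastforce
qed

end

section \<open>Boundary values of the Herglotz transform\<close>

lemma measurable_cis [measurable]: "cis \<in> borel_measurable borel"
  by (intro borel_measurable_continuous_onI continuous_on_cis continuous_on_id)

lemma measurable_cnj [measurable]: "cnj \<in> borel_measurable borel"
  by (intro borel_measurable_continuous_onI continuous_on_cnj continuous_on_id)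

definition circle_haar :: "complex measure" where
  "circle_haar = distr (density lborel (\<lambda>\<theta>. ennreal (indicator {-pi..pi} \<theta> / (2 * pi)))) borel cis"

lemma integral_circle_haar:
  fixes f :: "complex \<Rightarrow> 'b::{banach, second_countable_topology}"
  assumes [measurable]: "f \<in> borel_measurable borel"
  shows "(\<integral>z. f z \<partial>circle_haar) = (\<integral>\<theta>. (indicator {-pi..pi} \<theta> / (2 * pi)) *\<^sub>R f (cis \<theta>) \<partial>lborel)"
  unfolding circle_haar_def by (subst integral_distr; (subst integral_density)?) auto

lemma nn_integral_circle_haar:
  assumes [measurable]: "f \<in> borel_measurable borel"
  shows "(\<integral>\<^sup>+z. f z \<partial>circle_haar)
    = (\<integral>\<^sup>+\<theta>. ennreal (indicator {-pi..pi} \<theta> / (2 * pi)) * f (cis \<theta>) \<partial>lborel)"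
  unfolding circle_haar_def by (subst nn_integral_distr; (subst nn_integral_density)?) auto

lemma prob_space_circle_haar: "prob_space circle_haar"
proof (rule prob_spaceI)
  have "emeasure circle_haar (space circle_haar) = (\<integral>\<^sup>+z. 1 \<partial>circle_haar)"
    by simp
  also have "\<dots> = (\<integral>\<^sup>+\<theta>. ennreal (1 / (2 * pi)) * indicator {-pi..pi} \<theta> \<partial>lborel)"
    by (subst nn_integral_circle_haar) (auto intro!: nn_integral_cong split: split_indicator)
  also have "\<dots> = 1"
    by (subst nn_integral_cmult_indicator) (auto simp flip: ennreal_mult)
  finally show "emeasure circle_haar (space circle_haar) = 1" .
qed

interpretation circle_haar: circle_measure circle_haar
proof (intro circle_measure.intro circle_measure_axioms.intro prob_space_circle_haar)
  show "sets circle_haar = sets borel"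
    by (simp add: circle_haar_def)
  show "AE z in circle_haar. cmod z = 1"
    unfolding circle_haar_def by (subst AE_distr_iff) auto
qed

lemma circle_haar_orthogonal:
  "(\<integral>z. z ^ j * cnj z ^ k \<partial>circle_haar) = (if j = k then 1 else 0)"
proof (cases "j = k")
  case True
  have "(\<integral>z. z ^ j * cnj z ^ k \<partial>circle_haar) = (\<integral>z. 1 \<partial>circle_haar)"
    using circle_haar.AE_circle True
    by (intro integral_cong_AE) (auto simp: complex_norm_square[symmetric] simp flip: power_mult_distrib elim!: eventually_mono)
  with True show ?thesis by (simp add: circle_haar.prob_space)
next
  case False
  define m where "m = real j - real k"
  have m: "m \<noteq> 0" using False by (simp add: m_def)
  define F where "F \<theta> = cis (m * \<theta>) / (\<i> * m)" for \<theta>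
  have cis: "cis \<theta> ^ j * cnj (cis \<theta>) ^ k = cis (m * \<theta>)" for \<theta>
    by (simp only: cis_cnj Complex.DeMoivre cis_mult m_def) (rule arg_cong[of _ _ cis], simp add: algebra_simps)
  have "(\<integral>z. z ^ j * cnj z ^ k \<partial>circle_haar)
      = (\<integral>\<theta>. (1 / (2 * pi)) *\<^sub>R (indicator {-pi..pi} \<theta> *\<^sub>R cis (m * \<theta>)) \<partial>lborel)"
    by (subst integral_circle_haar) (simp_all add: cis)
  also have "\<dots> = (1 / (2 * pi)) *\<^sub>R (\<integral>\<theta>. indicator {-pi..pi} \<theta> *\<^sub>R cis (m * \<theta>) \<partial>lborel)"
    by (rule integral_scaleR_right)
  also have "(\<integral>\<theta>. indicator {-pi..pi} \<theta> *\<^sub>R cis (m * \<theta>) \<partial>lborel) = F pi - F (- pi)"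
  proof (rule integral_FTC_Icc)
    show "(F has_vector_derivative cis (m * x)) (at x within {-pi..pi})" for x
    proof -
      have "((\<lambda>w. exp (\<i> * of_real m * w) / (\<i> * m)) has_field_derivative exp (\<i> * of_real m * of_real x))
          (at (of_real x))"
        by (auto intro!: derivative_eq_intros simp: m)
      from has_vector_derivative_real_field[OF this] show ?thesis
        by (simp add: F_def[abs_def] cis_conv_exp mult.assoc)
    qed
  qed (auto intro!: continuous_intros)
  also have "F pi - F (- pi) = 0"
  proof -
    have "cis (m * pi) = cis (- (m * pi))"
      using sin_integer_2pi[of "0"] by (simp add: complex_eq_iff m_def left_diff_distrib sin_diff cos_diff)
    then show ?thesis by (simp add: F_def)
  qed
  finally show ?thesis using False by simp
qed

text \<open>On the circle \<open>cnj z\<close> is 1 / z, so real parts of ordinary polynomials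
  already give all real trigonometric polynomials there, and moments with nonnegative exponents
  suffice to integrate them.\<close>

inductive trig_polynomial :: "(complex \<Rightarrow> real) \<Rightarrow> bool" where
  monomial: "trig_polynomial (\<lambda>z. Re (c * z ^ k))"
| add: "trig_polynomial f \<Longrightarrow> trig_polynomial g \<Longrightarrow> trig_polynomial (\<lambda>z. f z + g z)"

text \<open>Re x * Re y is the mean of Re (x y) and Re (x cnj y). On the circle the second product
  is a monomial with nonnegative exponent if x has at least the degree of y; otherwise the factors
  exchange roles.\<close>

lemma trig_polynomial_monomial_mult:
  "\<exists>h. trig_polynomial h \<and> (\<forall>z. cmod z = 1 \<longrightarrow> h z = Re (c * z ^ j) * Re (d * z ^ k))"
proof -
  have *: "\<exists>h. trig_polynomial h \<and> (\<forall>z. cmod z = 1 \<longrightarrow> h z = Re (c * z ^ (i + k)) * Re (d * z ^ k))"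
    for c d i k
  proof (intro exI conjI allI impI)
    show "trig_polynomial (\<lambda>z. Re (c * d / 2 * z ^ (i + k + k)) + Re (c * cnj d / 2 * z ^ i))"
      by (intro trig_polynomial.intros)
    fix z assume "cmod z = 1"
    then have zz: "z ^ k * cnj z ^ k = 1"
      by (simp flip: power_mult_distrib complex_norm_square)
    have "c * z ^ (i + k) * cnj (d * z ^ k) = c * cnj d * z ^ i * (z ^ k * cnj z ^ k)"
      by (simp add: power_add)
    then have eq: "c * cnj d * z ^ i = c * z ^ (i + k) * cnj (d * z ^ k)"
      by (simp only: zz mult_1_right)
    have Re_mult: "Re x * Re y = (Re (x * y) + Re (x * cnj y)) / 2" for x y
      by simp
    show "Re (c * d / 2 * z ^ (i + k + k)) + Re (c * cnj d / 2 * z ^ i)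
        = Re (c * z ^ (i + k)) * Re (d * z ^ k)"
    proof -
      have "c * d / 2 * z ^ (i + k + k) = (c * z ^ (i + k)) * (d * z ^ k) / 2"
        by (simp add: power_add)
      moreover have "c * cnj d / 2 * z ^ i = c * z ^ (i + k) * cnj (d * z ^ k) / 2"
        by (simp only: eq times_divide_eq_left)
      ultimately show ?thesis
        unfolding Re_mult by (simp only: Re_divide_numeral add_divide_distrib)
    qed
  qed
  consider i where "j = i + k" | i where "k = i + j"
    by (metis le_add_diff_inverse2 linear)
  then show ?thesis
  proof cases
    case 1
    with * show ?thesis by blast
  next
    case 2
    with *[of d i j c] show ?thesis by (simp add: mult.commute)
  qed
qed

lemma trig_polynomial_mult:
  assumes "trig_polynomial f" "trig_polynomial g"
  shows "\<exists>h. trig_polynomial h \<and> (\<forall>z. cmod z = 1 \<longrightarrow> h z = f z * g z)"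
  using assms(1)
proof induction
  case (monomial c j)
  show ?case
    using assms(2)
  proof induction
    case (add f g)
    then obtain h1 h2 where "trig_polynomial h1" "\<forall>z. cmod z = 1 \<longrightarrow> h1 z = Re (c * z ^ j) * f z"
      "trig_polynomial h2" "\<forall>z. cmod z = 1 \<longrightarrow> h2 z = Re (c * z ^ j) * g z"
      by auto
    then show ?case
      by (intro exI[of _ "\<lambda>z. h1 z + h2 z"]) (auto intro: trig_polynomial.add simp: distrib_left simp del: times_complex.sel)
  qed (rule trig_polynomial_monomial_mult)
next
  case (add f f')
  then obtain h1 h2 where "trig_polynomial h1" "\<forall>z. cmod z = 1 \<longrightarrow> h1 z = f z * g z"
    "trig_polynomial h2" "\<forall>z. cmod z = 1 \<longrightarrow> h2 z = f' z * g z"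
    by auto
  then show ?case
    by (intro exI[of _ "\<lambda>z. h1 z + h2 z"]) (auto intro: trig_polynomial.add simp: distrib_right)
qed

lemma real_polynomial_function_trig:
  fixes p :: "complex \<Rightarrow> real"
  assumes "real_polynomial_function p"
  shows "\<exists>h. trig_polynomial h \<and> (\<forall>z. cmod z = 1 \<longrightarrow> h z = p z)"
  using assms
proof induction
  case (linear f)
  interpret f: bounded_linear f by fact
  \<comment> \<open>A real-linear functional on the complex plane is z \<mapsto> Re (c z);
    evaluating at 1 and \<i> gives c.\<close>
  have "Re ((f 1 - \<i> * f \<i>) * z ^ 1) = f z" for z
  proof -
    have "f z = f (Re z *\<^sub>R 1 + Im z *\<^sub>R \<i>)"
      by (rule arg_cong[of _ _ f]) (simp add: complex_eq_iff)
    then show ?thesis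
      by (simp only: f.add f.scaleR) (simp add: mult.commute)
  qed
  then show ?case
    using trig_polynomial.monomial[of "f 1 - \<i> * f \<i>" 1] by blast
next
  case (const c)
  show ?case
    using trig_polynomial.monomial[of c 0] by auto
next
  case (add f g)
  then obtain h1 h2 where "trig_polynomial h1" "\<forall>z. cmod z = 1 \<longrightarrow> h1 z = f z"
    "trig_polynomial h2" "\<forall>z. cmod z = 1 \<longrightarrow> h2 z = g z"
    by auto
  then show ?case
    by (intro exI[of _ "\<lambda>z. h1 z + h2 z"]) (auto intro: trig_polynomial.add)
next
  case (mult f g)
  then obtain h1 h2 where "trig_polynomial h1" "\<forall>z. cmod z = 1 \<longrightarrow> h1 z = f z"
    "trig_polynomial h2" "\<forall>z. cmod z = 1 \<longrightarrow> h2 z = g z"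
    by auto
  then show ?case
    using trig_polynomial_mult[of h1 h2] by auto
qed

lemma continuous_trig_polynomial: "trig_polynomial f \<Longrightarrow> continuous_on A f"
  by (induction rule: trig_polynomial.induct) (auto intro!: continuous_intros simp del: times_complex.sel)

lemma continuous_bounded_on_circle:
  fixes f :: "complex \<Rightarrow> real"
  assumes "continuous_on UNIV f"
  obtains B where "\<And>z. cmod z = 1 \<Longrightarrow> \<bar>f z\<bar> \<le> B" "0 \<le> B"
proof -
  have "compact (f ` sphere 0 1)"
    by (intro compact_continuous_image continuous_on_subset[OF assms]) auto
  then obtain B where "\<And>z. z \<in> sphere 0 1 \<Longrightarrow> norm (f z) \<le> B"
    using compact_imp_bounded bounded_iff by (metis imageI)
  then have B: "\<And>z. cmod z = 1 \<Longrightarrow> \<bar>f z\<bar> \<le> B"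
    by auto
  from B[of 1] have "0 \<le> B" by simp
  with B that show thesis by blast
qed

section \<open>Weak convergence of the radial densities to the law\<close>

context free_symmetries_law
begin

lemma integrable_continuous:
  fixes f :: "complex \<Rightarrow> real"
  assumes "continuous_on UNIV f"
  shows "integrable \<nu> f"
proof -
  obtain B where "\<And>z. cmod z = 1 \<Longrightarrow> \<bar>f z\<bar> \<le> B"
    using continuous_bounded_on_circle[OF assms] by blast
  then show ?thesis
    by (intro integrable_circle borel_measurable_continuous_onI[OF assms]) auto
qed

lemma herglotz_re_bound:
  assumes "0 \<le> r" "r < 1" "cmod z = 1"
  shows "herglotz_re \<alpha> \<beta> (of_real r * z) \<le> 2 / (1 - r)"
proof -
  have z: "cmod (of_real r * z) < 1" "cmod (of_real r * z) = r"
    using assms by (simp_all add: norm_mult)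
  have "cmod (cauchy_transform (of_real r * z)) \<le> (\<integral>\<zeta>. cmod (1 / (1 - of_real r * z * \<zeta>)) \<partial>\<nu>)"
    unfolding cauchy_transform_def by (rule integral_norm_bound)
  also have "\<dots> \<le> (\<integral>\<zeta>. 1 / (1 - r) \<partial>\<nu>)"
  proof (rule integral_mono_AE)
    show "AE \<zeta> in \<nu>. cmod (1 / (1 - of_real r * z * \<zeta>)) \<le> 1 / (1 - r)"
      using AE_circle cauchy_kernel_bound[OF z(1)] z(2) by (auto elim!: eventually_mono)
  qed (use integrable_cauchy_kernel[OF z(1)] in \<open>auto simp del: norm_divide\<close>)
  also have "\<dots> = 1 / (1 - r)"
    by (simp add: prob_space)
  finally have "Re (cauchy_transform (of_real r * z)) \<le> 1 / (1 - r)"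
    using complex_Re_le_cmod order_trans by blast
  then show ?thesis
    using Re_herglotz[OF z(1)] by simp
qed

lemma integrable_mult_herglotz_re:
  fixes f :: "complex \<Rightarrow> real"
  assumes "continuous_on UNIV f" "0 \<le> r" "r < 1"
  shows "integrable circle_haar (\<lambda>z. f z * herglotz_re \<alpha> \<beta> (of_real r * z))"
proof -
  obtain B where B: "\<And>z. cmod z = 1 \<Longrightarrow> \<bar>f z\<bar> \<le> B" "0 \<le> B"
    using continuous_bounded_on_circle[OF assms(1)] by blast
  have [measurable]: "f \<in> borel_measurable borel"
    by (rule borel_measurable_continuous_onI[OF assms(1)])
  show ?thesis
  proof (rule circle_haar.integrable_circle)
    show "norm (f z * herglotz_re \<alpha> \<beta> (of_real r * z)) \<le> B * (2 / (1 - r))" if "cmod z = 1" for z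
      unfolding real_norm_def abs_mult using that assms B
      by (intro mult_mono) (simp_all add: herglotz_re_bound herglotz_re_nonneg)
  qed measurable
qed

text \<open>Re H is the Poisson integral of the law, and the Poisson kernel of radius r scales the
  k-th moment by r^k. The case k = 0 says that every radial density has total mass 1.\<close>

lemma herglotz_re_moment:
  assumes r: "0 \<le> r" "r < 1"
  shows "(\<integral>z. z ^ k * of_real (herglotz_re \<alpha> \<beta> (of_real r * z)) \<partial>circle_haar) = of_real r ^ k * moment k"
proof -
  \<comment> \<open>The n-th term of z^k times \<psi> plus its conjugate, taken at r * cnj z. The
    conjugate point makes \<open>moment n\<close> appear with \<open>cnj z ^ n\<close>, so that
    orthogonality selects n = k; \<open>herglotz_re_cnj\<close> moves the point back.\<close>
  define f where "f n z = z ^ k * (moment n * (of_real r * cnj z) ^ n + cnj (moment n) * (of_real r * z) ^ n)"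
    for n z
  have norm_f: "norm (f n z) \<le> 2 * r ^ n" if "cmod z = 1" for n z
  proof -
    have "norm (f n z) \<le> cmod (moment n) * r ^ n + cmod (moment n) * r ^ n"
      using that r norm_triangle_ineq[of "moment n * (of_real r * cnj z) ^ n" "cnj (moment n) * (of_real r * z) ^ n"]
      by (simp add: f_def norm_mult norm_power)
    also have "\<dots> \<le> 1 * r ^ n + 1 * r ^ n"
      using norm_moment_le r by (intro add_mono mult_right_mono) auto
    finally show ?thesis by simp
  qed
  have [measurable]: "f n \<in> borel_measurable borel" for n
    unfolding f_def[abs_def] by measurable
  have int_f: "integrable circle_haar (f n)" for n
    by (rule circle_haar.integrable_circle[OF _ norm_f]) measurable
  \<comment> \<open>The moment of order 0 occurs in \<psi> and again in its conjugate, whereas Re H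
    has the constant term 1; this is the extra z^k.\<close>
  have f_sums: "(\<lambda>n. f n z) sums (z ^ k * of_real (herglotz_re \<alpha> \<beta> (of_real r * z)) + z ^ k)"
    if z: "cmod z = 1" for z
  proof -
    let ?w = "of_real r * cnj z"
    have w: "cmod ?w < 1"
      using z r by (simp add: norm_mult)
    have "(\<lambda>n. cnj (moment n * ?w ^ n)) sums cnj (cauchy_transform ?w)"
      unfolding sums_cnj by (rule moment_sums[OF w])
    from sums_mult[OF sums_add[OF moment_sums[OF w] this], of "z ^ k"]
    have "(\<lambda>n. f n z) sums (z ^ k * (cauchy_transform ?w + cnj (cauchy_transform ?w)))"
      by (simp add: f_def)
    moreover have "of_real (herglotz_re \<alpha> \<beta> (of_real r * z)) = cauchy_transform ?w + cnj (cauchy_transform ?w) - 1"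
      (is "?h = _")
    proof -
      have "herglotz_re \<alpha> \<beta> (of_real r * z) = Re (2 * cauchy_transform ?w - 1)"
        using Re_herglotz[OF w] herglotz_re_cnj[of \<alpha> \<beta> "of_real r * z"] by simp
      then show ?thesis
        by (simp add: complex_add_cnj)
    qed
    then have "cauchy_transform ?w + cnj (cauchy_transform ?w) = ?h + 1"
      by simp
    ultimately show ?thesis
      by (simp only: distrib_left mult_1_right)
  qed
  have summ: "summable (\<lambda>n. 2 * r ^ n)"
    using r by (intro summable_mult summable_geometric) simp
  have int_sums: "(\<lambda>n. integral\<^sup>L circle_haar (f n)) sums (\<integral>z. (\<Sum>n. f n z) \<partial>circle_haar)"
  proof (rule sums_integral[OF int_f])
    show "AE z in circle_haar. summable (\<lambda>n. norm (f n z))"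
      using circle_haar.AE_circle
    proof eventually_elim
      case (elim z)
      show ?case
        by (rule summable_comparison_test[OF _ summ]) (use norm_f[OF elim] in auto)
    qed
    have "(\<integral>z. norm (f n z) \<partial>circle_haar) \<le> 2 * r ^ n" for n
    proof -
      have "(\<integral>z. norm (f n z) \<partial>circle_haar) \<le> (\<integral>z. 2 * r ^ n \<partial>circle_haar)"
        using circle_haar.AE_circle norm_f int_f
        by (intro integral_mono_AE) (auto elim!: eventually_mono)
      then show ?thesis by (simp add: circle_haar.prob_space)
    qed
    then show "summable (\<lambda>n. \<integral>z. norm (f n z) \<partial>circle_haar)"
      by (intro summable_comparison_test[OF _ summ]) auto
  qed
  have "(\<integral>z. (\<Sum>n. f n z) \<partial>circle_haar)
      = (\<integral>z. z ^ k * of_real (herglotz_re \<alpha> \<beta> (of_real r * z)) + z ^ k \<partial>circle_haar)"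
    using circle_haar.AE_circle
    by (intro integral_cong_AE) (auto dest!: f_sums sums_unique elim!: eventually_mono)
  also have "\<dots> = (\<integral>z. z ^ k * of_real (herglotz_re \<alpha> \<beta> (of_real r * z)) \<partial>circle_haar)
      + (\<integral>z. z ^ k \<partial>circle_haar)"
  proof (rule Bochner_Integration.integral_add)
    show "integrable circle_haar (\<lambda>z. z ^ k * complex_of_real (herglotz_re \<alpha> \<beta> (complex_of_real r * z)))"
      using herglotz_re_bound[OF r] herglotz_re_nonneg
      by (intro circle_haar.integrable_circle[of _ "2 / (1 - r)"]) (auto simp: norm_mult norm_power)
    show "integrable circle_haar (\<lambda>z. z ^ k)"
      by (rule circle_haar.integrable_circle[of _ 1]) (auto simp: norm_power)
  qed
  also have "(\<integral>z. z ^ k \<partial>circle_haar) = (if k = 0 then 1 else 0)"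
    using circle_haar_orthogonal[of k 0] by simp
  finally have *: "(\<lambda>n. integral\<^sup>L circle_haar (f n)) sums
      ((\<integral>z. z ^ k * of_real (herglotz_re \<alpha> \<beta> (of_real r * z)) \<partial>circle_haar) + (if k = 0 then 1 else 0))"
    using int_sums by simp
  have "integral\<^sup>L circle_haar (f n) = (if n = k then moment n * of_real r ^ n else 0)
      + (if n = 0 then if k = 0 then 1 else 0 else 0)" for n
  proof -
    have int: "integrable circle_haar (\<lambda>z. z ^ i * cnj z ^ j)" for i j
      by (rule circle_haar.integrable_circle[of _ 1]) (auto simp: norm_mult norm_power)
    have f_eq: "f n z = moment n * of_real r ^ n * (z ^ k * cnj z ^ n)
        + cnj (moment n) * of_real r ^ n * (z ^ (k + n) * cnj z ^ 0)" for z
      by (simp add: f_def power_mult_distrib power_add algebra_simps)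
    have "integral\<^sup>L circle_haar (f n) = moment n * of_real r ^ n * (\<integral>z. z ^ k * cnj z ^ n \<partial>circle_haar)
        + cnj (moment n) * of_real r ^ n * (\<integral>z. z ^ (k + n) * cnj z ^ 0 \<partial>circle_haar)"
      unfolding f_eq
      by (subst Bochner_Integration.integral_add)
        (intro integrable_mult_right int, intro integrable_mult_right int, simp only: integral_mult_right_zero)
    then show ?thesis
      unfolding circle_haar_orthogonal by auto
  qed
  moreover have "(\<lambda>n. (if n = k then moment n * of_real r ^ n else 0)
      + (if n = 0 then if k = 0 then 1 else 0 else 0)) sums
      (moment k * of_real r ^ k + (if k = 0 then 1 else 0))"
    by (intro sums_add sums_single)
  ultimately have "(\<lambda>n. integral\<^sup>L circle_haar (f n)) sums
      (moment k * of_real r ^ k + (if k = 0 then 1 else 0))"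
    by simp
  with * have "(\<integral>z. z ^ k * of_real (herglotz_re \<alpha> \<beta> (of_real r * z)) \<partial>circle_haar)
      + (if k = 0 then 1 else 0) = moment k * of_real r ^ k + (if k = 0 then 1 else 0)"
    by (rule sums_unique2)
  then show ?thesis
    by (simp add: mult.commute)
qed

lemma herglotz_re_trig_polynomial_limit:
  assumes "trig_polynomial f" and r: "\<And>n. 0 \<le> r n" "\<And>n. r n < 1" "r \<longlonglongrightarrow> (1::real)"
  shows "(\<lambda>n. \<integral>z. f z * herglotz_re \<alpha> \<beta> (of_real (r n) * z) \<partial>circle_haar) \<longlonglongrightarrow> (\<integral>z. f z \<partial>\<nu>)"
  using assms(1)
proof induction
  case (monomial c k)
  have int: "integrable circle_haar (\<lambda>z. z ^ k * complex_of_real (herglotz_re \<alpha> \<beta> (of_real (r n) * z)))" for n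
    using herglotz_re_bound[OF r(1,2)] herglotz_re_nonneg
    by (intro circle_haar.integrable_circle[of _ "2 / (1 - r n)"]) (auto simp: norm_mult norm_power)
  have int': "integrable \<nu> (\<lambda>z. z ^ k)"
    by (rule integrable_circle[of _ 1]) (auto simp: norm_power)
  have "(\<integral>z. Re (c * z ^ k) * herglotz_re \<alpha> \<beta> (of_real (r n) * z) \<partial>circle_haar)
      = Re (c * (of_real (r n) ^ k * moment k))" for n
  proof -
    have "(\<integral>z. Re (c * z ^ k) * herglotz_re \<alpha> \<beta> (of_real (r n) * z) \<partial>circle_haar)
        = (\<integral>z. Re (c * (z ^ k * of_real (herglotz_re \<alpha> \<beta> (of_real (r n) * z)))) \<partial>circle_haar)"
      by (simp add: algebra_simps)
    also have "\<dots> = Re (c * (\<integral>z. z ^ k * of_real (herglotz_re \<alpha> \<beta> (of_real (r n) * z)) \<partial>circle_haar))"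
      by (subst integral_Re[OF integrable_mult_right[OF int]]) (simp only: integral_mult_right_zero)
    finally show ?thesis
      by (simp only: herglotz_re_moment[OF r(1,2)])
  qed
  moreover have "(\<lambda>n. Re (c * (of_real (r n) ^ k * moment k))) \<longlonglongrightarrow> Re (c * (of_real 1 ^ k * moment k))"
    by (intro tendsto_intros r(3))
  moreover have "Re (c * (of_real 1 ^ k * moment k)) = (\<integral>z. Re (c * z ^ k) \<partial>\<nu>)"
    by (subst integral_Re[OF integrable_mult_right[OF int']]) (simp add: moment_def)
  ultimately show ?case
    by (simp only:)
next
  case (add f g)
  have "(\<integral>z. (f z + g z) * herglotz_re \<alpha> \<beta> (of_real (r n) * z) \<partial>circle_haar) =
      (\<integral>z. f z * herglotz_re \<alpha> \<beta> (of_real (r n) * z) \<partial>circle_haar)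
      + (\<integral>z. g z * herglotz_re \<alpha> \<beta> (of_real (r n) * z) \<partial>circle_haar)" for n
    unfolding distrib_right using add.hyps
    by (intro Bochner_Integration.integral_add integrable_mult_herglotz_re continuous_trig_polynomial r)
  moreover have "(\<integral>z. f z + g z \<partial>\<nu>) = (\<integral>z. f z \<partial>\<nu>) + (\<integral>z. g z \<partial>\<nu>)"
    using add.hyps
    by (intro Bochner_Integration.integral_add integrable_continuous continuous_trig_polynomial)
  ultimately show ?case
    using tendsto_add[OF add.IH] by (simp only:)
qed

text \<open>Trigonometric polynomials are uniformly dense on the circle. Since the radial densities
  are nonnegative with total mass 1, the approximation error is the same for all radii.\<close>

lemma herglotz_re_limit:
  assumes f: "continuous_on UNIV f" and r: "\<And>n. 0 \<le> r n" "\<And>n. r n < 1" "r \<longlonglongrightarrow> (1::real)"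
  shows "(\<lambda>n. \<integral>z. f z * herglotz_re \<alpha> \<beta> (of_real (r n) * z) \<partial>circle_haar) \<longlonglongrightarrow> (\<integral>z. f z \<partial>\<nu>)"
proof (rule LIMSEQ_I)
  fix e :: real assume "0 < e"
  define I where "I n g = (\<integral>z. g z * herglotz_re \<alpha> \<beta> (of_real (r n) * z) \<partial>circle_haar)"
    for n and g :: "complex \<Rightarrow> real"
  obtain p where "real_polynomial_function p" "\<And>z. z \<in> sphere 0 1 \<Longrightarrow> \<bar>f z - p z\<bar> < e / 4"
    using Stone_Weierstrass_real_polynomial_function[of "sphere 0 1" f "e / 4"]
      continuous_on_subset[OF f] \<open>0 < e\<close> by auto
  then obtain g where g: "trig_polynomial g" "\<And>z. cmod z = 1 \<Longrightarrow> \<bar>f z - g z\<bar> < e / 4"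
    using real_polynomial_function_trig[of p] by fastforce
  note cont_g = continuous_trig_polynomial[OF g(1), of UNIV]
  have 1: "\<bar>I n f - I n g\<bar> \<le> e / 4" for n
  proof -
    have "I n f - I n g = (\<integral>z. (f z - g z) * herglotz_re \<alpha> \<beta> (of_real (r n) * z) \<partial>circle_haar)"
      unfolding I_def left_diff_distrib
      by (intro Bochner_Integration.integral_diff[symmetric] integrable_mult_herglotz_re f cont_g r)
    also have "\<bar>\<dots>\<bar> \<le> (\<integral>z. \<bar>(f z - g z) * herglotz_re \<alpha> \<beta> (of_real (r n) * z)\<bar> \<partial>circle_haar)"
      by (rule integral_abs_bound)
    also have "\<dots> \<le> (\<integral>z. e / 4 * herglotz_re \<alpha> \<beta> (of_real (r n) * z) \<partial>circle_haar)"
    proof (rule integral_mono_AE)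
      show "integrable circle_haar (\<lambda>z. \<bar>(f z - g z) * herglotz_re \<alpha> \<beta> (of_real (r n) * z)\<bar>)"
        by (intro integrable_abs integrable_mult_herglotz_re continuous_on_diff f cont_g r)
      show "integrable circle_haar (\<lambda>z. e / 4 * herglotz_re \<alpha> \<beta> (of_real (r n) * z))"
        by (intro integrable_mult_herglotz_re continuous_on_const r)
      show "AE z in circle_haar. \<bar>(f z - g z) * herglotz_re \<alpha> \<beta> (of_real (r n) * z)\<bar>
          \<le> e / 4 * herglotz_re \<alpha> \<beta> (of_real (r n) * z)"
        using circle_haar.AE_circle
      proof eventually_elim
        case (elim z)
        show ?case
          unfolding abs_mult
          using \<open>0 < e\<close> g(2)[OF elim] herglotz_re_nonneg[of \<alpha> \<beta> "of_real (r n) * z"]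
          by (intro mult_mono) auto
      qed
    qed
    also have "\<dots> = e / 4 * (\<integral>z. herglotz_re \<alpha> \<beta> (of_real (r n) * z) \<partial>circle_haar)"
      by (rule integral_mult_right_zero)
    also have "(\<integral>z. herglotz_re \<alpha> \<beta> (of_real (r n) * z) \<partial>circle_haar) = 1"
      using herglotz_re_moment[OF r(1)[of n] r(2)[of n], of 0] by (simp add: of_real_eq_1_iff)
    finally show ?thesis by simp
  qed
  have 2: "\<bar>(\<integral>z. f z \<partial>\<nu>) - (\<integral>z. g z \<partial>\<nu>)\<bar> \<le> e / 4"
  proof -
    have "(\<integral>z. f z \<partial>\<nu>) - (\<integral>z. g z \<partial>\<nu>) = (\<integral>z. f z - g z \<partial>\<nu>)"
      by (intro Bochner_Integration.integral_diff[symmetric] integrable_continuous f cont_g)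
    also have "\<bar>\<dots>\<bar> \<le> (\<integral>z. \<bar>f z - g z\<bar> \<partial>\<nu>)"
      by (rule integral_abs_bound)
    also have "\<dots> \<le> (\<integral>z. e / 4 \<partial>\<nu>)"
      using AE_circle g(2)
      by (intro integral_mono_AE integrable_abs Bochner_Integration.integrable_diff integrable_continuous f cont_g)
        (auto elim!: eventually_mono intro: less_imp_le)
    finally show ?thesis by (simp add: prob_space)
  qed
  obtain N where N: "\<And>n. n \<ge> N \<Longrightarrow> \<bar>I n g - (\<integral>z. g z \<partial>\<nu>)\<bar> < e / 4"
    using LIMSEQ_D[OF herglotz_re_trig_polynomial_limit[OF g(1) r], of "e / 4"] \<open>0 < e\<close>
    by (auto simp: I_def)
  have "norm (I n f - (\<integral>z. f z \<partial>\<nu>)) < e" if "n \<ge> N" for n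
    using 1[of n] 2 N[OF that] \<open>0 < e\<close> unfolding real_norm_def by linarith
  then show "\<exists>N. \<forall>n\<ge>N. norm ((\<integral>z. f z * herglotz_re \<alpha> \<beta> (of_real (r n) * z) \<partial>circle_haar) - (\<integral>z. f z \<partial>\<nu>)) < e"
    unfolding I_def by blast
qed

text \<open>Where f does not vanish, the radial densities stay in a compact set on which Re H is
  continuous, boundary included, so dominated convergence applies.\<close>

lemma integral_away_from_atoms:
  assumes f: "continuous_on UNIV f" and \<delta>: "0 < \<delta>" "\<And>z. cmod (z\<^sup>2 - 1) < \<delta> \<Longrightarrow> f z = 0"
  shows "integrable circle_haar (\<lambda>z. f z * herglotz_re \<alpha> \<beta> z)"
    and "(\<integral>z. f z \<partial>\<nu>) = (\<integral>z. f z * herglotz_re \<alpha> \<beta> z \<partial>circle_haar)"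
proof -
  have [measurable]: "f \<in> borel_measurable borel"
    by (rule borel_measurable_continuous_onI[OF f])
  obtain B where B: "\<And>z. cmod z = 1 \<Longrightarrow> \<bar>f z\<bar> \<le> B" "0 \<le> B"
    using continuous_bounded_on_circle[OF f] by blast
  define K where "K = cball 0 1 \<inter> {z :: complex. \<delta> / 2 \<le> cmod (z\<^sup>2 - 1)}"
  have "compact K"
    unfolding K_def
    by (intro compact_Int_closed compact_cball closed_Collect_le continuous_intros)
  moreover have "continuous_on K (herglotz_re \<alpha> \<beta>)"
  proof (unfold continuous_on_def, intro ballI tendsto_herglotz_re tendsto_ident_at)
    fix z assume "z \<in> K"
    with \<delta>(1) show "z\<^sup>2 \<noteq> 1" by (auto simp: K_def)
  qed
  ultimately have "compact (herglotz_re \<alpha> \<beta> ` K)"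
    by (intro compact_continuous_image)
  then obtain C where C: "\<And>z. z \<in> K \<Longrightarrow> norm (herglotz_re \<alpha> \<beta> z) \<le> C"
    using compact_imp_bounded bounded_iff by (metis imageI)
  \<comment> \<open>With 1 - r \<le> \<delta> / 4, moving from z to r z changes z^2 by 1 - r^2 \<le>
    \<delta> / 2, so the point stays in K, whose margin is half of \<delta>. The bound 1/2 keeps r
    nonnegative.\<close>
  define d where "d = min (1/2) (\<delta> / 4)"
  have d: "0 < d" "d \<le> 1 / 2" "d \<le> \<delta> / 4" using \<delta>(1) by (auto simp: d_def)
  define r where "r n = 1 - d * inverse (real (Suc n))" for n
  have d_bound: "d * inverse (real (Suc n)) \<le> d" "0 < d * inverse (real (Suc n))" for n
    using d(1) by (auto simp: field_simps)
  then have r: "0 \<le> r n" "r n < 1" "1 - r n \<le> d" for n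
    using d(2) d_bound[of n] unfolding r_def by linarith+
  have lim: "r \<longlonglongrightarrow> 1"
    unfolding r_def[abs_def]
    using tendsto_diff[OF tendsto_const tendsto_mult[OF tendsto_const LIMSEQ_inverse_real_of_nat], of 1 d] by simp
  have K: "of_real (r n) * z \<in> K" if z: "cmod z = 1" "f z \<noteq> 0" for n z
  proof -
    have "\<delta> \<le> cmod (z\<^sup>2 - 1)"
      using \<delta>(2)[of z] z by force
    moreover have "cmod (z\<^sup>2 - 1) \<le> cmod ((of_real (r n) * z)\<^sup>2 - 1) + cmod (z\<^sup>2 - (of_real (r n) * z)\<^sup>2)"
      using norm_triangle_ineq[of "(of_real (r n) * z)\<^sup>2 - 1" "z\<^sup>2 - (of_real (r n) * z)\<^sup>2"] by simp
    moreover have "cmod (z\<^sup>2 - (of_real (r n) * z)\<^sup>2) \<le> \<delta> / 2"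
    proof -
      have "z\<^sup>2 - (of_real (r n) * z)\<^sup>2 = of_real (1 - (r n)\<^sup>2) * z\<^sup>2"
        by (simp add: power_mult_distrib left_diff_distrib)
      then have "cmod (z\<^sup>2 - (of_real (r n) * z)\<^sup>2) = \<bar>1 - (r n)\<^sup>2\<bar>"
        using z(1) by (simp only: norm_mult norm_of_real norm_power) simp
      also have "1 - (r n)\<^sup>2 = (1 - r n) * (1 + r n)"
        by (simp add: power2_eq_square algebra_simps)
      also have "\<bar>\<dots>\<bar> = (1 - r n) * (1 + r n)"
        using r[of n] by (simp add: abs_mult)
      also have "\<dots> \<le> \<delta> / 4 * 2"
        using r[of n] d by (intro mult_mono) auto
      finally show ?thesis by simp
    qed
    ultimately have "\<delta> / 2 \<le> cmod ((of_real (r n) * z)\<^sup>2 - 1)"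
      by linarith
    then show ?thesis
      using z(1) r[of n] by (simp add: K_def norm_mult)
  qed
  let ?F = "\<lambda>n z. f z * herglotz_re \<alpha> \<beta> (of_real (r n) * z)"
  have conv: "AE z in circle_haar. (\<lambda>n. ?F n z) \<longlonglongrightarrow> f z * herglotz_re \<alpha> \<beta> z"
  proof (rule always_eventually, intro allI)
    fix z
    show "(\<lambda>n. ?F n z) \<longlonglongrightarrow> f z * herglotz_re \<alpha> \<beta> z"
    proof (cases "f z = 0")
      case False
      then have "z\<^sup>2 \<noteq> 1"
        using \<delta> by force
      moreover have "(\<lambda>n. of_real (r n) * z) \<longlonglongrightarrow> of_real 1 * z"
        by (intro tendsto_intros lim)
      ultimately show ?thesis
        by (intro tendsto_mult tendsto_const tendsto_herglotz_re) simp_all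
    qed simp
  qed
  have bound: "AE z in circle_haar. norm (?F n z) \<le> B * \<bar>C\<bar>" for n
    using circle_haar.AE_circle
  proof eventually_elim
    case (elim z)
    show ?case
    proof (cases "f z = 0")
      case True
      then show ?thesis using B(2) by simp
    next
      case False
      then have "\<bar>herglotz_re \<alpha> \<beta> (of_real (r n) * z)\<bar> \<le> \<bar>C\<bar>"
        using C[OF K[OF elim False, of n]] by simp
      then show ?thesis
        unfolding real_norm_def abs_mult using B elim by (intro mult_mono) auto
    qed
  qed
  show "integrable circle_haar (\<lambda>z. f z * herglotz_re \<alpha> \<beta> z)"
    by (rule integrable_dominated_convergence[OF _ _ _ conv bound]) auto
  have "(\<lambda>n. integral\<^sup>L circle_haar (?F n)) \<longlonglongrightarrow> (\<integral>z. f z * herglotz_re \<alpha> \<beta> z \<partial>circle_haar)"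
    by (rule integral_dominated_convergence[OF _ _ _ conv bound]) auto
  moreover have "(\<lambda>n. integral\<^sup>L circle_haar (?F n)) \<longlonglongrightarrow> (\<integral>z. f z \<partial>\<nu>)"
    using r by (intro herglotz_re_limit f lim) auto
  ultimately show "(\<integral>z. f z \<partial>\<nu>) = (\<integral>z. f z * herglotz_re \<alpha> \<beta> z \<partial>circle_haar)"
    by (rule LIMSEQ_unique[symmetric])
qed

text \<open>Continuous cutoffs increase to the indicator of A, each vanishing near 1 and -1;
  monotone convergence passes from them to A.\<close>

lemma emeasure_open_away_from_atoms:
  assumes O: "open A" "1 \<notin> A" "- 1 \<notin> A"
  shows "emeasure \<nu> A = (\<integral>\<^sup>+z. ennreal (herglotz_re \<alpha> \<beta> z) * indicator A z \<partial>circle_haar)"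
proof -
  define g where "g z = infdist z (- A)" for z
  have g0: "0 \<le> g z" for z by (simp add: g_def infdist_nonneg)
  have g_pos: "0 < g z \<longleftrightarrow> z \<in> A" for z
  proof -
    have "z \<in> - A \<longleftrightarrow> infdist z (- A) = 0"
      using O by (intro in_closed_iff_infdist_zero) auto
    then show ?thesis using g0[of z] by (auto simp: g_def)
  qed
  \<comment> \<open>Subtracting 1 makes \<open>f n\<close> vanish wherever n * g z \<le> 1, hence in
    a neighbourhood of 1 and -1 and not merely at these points.\<close>
  define f where "f n z = min 1 (max 0 (real n * g z - 1))" for n z
  have cont: "continuous_on UNIV (f n)" for n
    unfolding f_def g_def by (intro continuous_intros)
  have [measurable]: "f n \<in> borel_measurable borel" for n
    by (rule borel_measurable_continuous_onI[OF cont])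
  have f01: "0 \<le> f n z" "f n z \<le> 1" for n z by (simp_all add: f_def)
  have f_mono: "f m z \<le> f n z" if "m \<le> n" for m n z
  proof -
    have "real m * g z \<le> real n * g z"
      using that g0[of z] by (intro mult_right_mono) auto
    then show ?thesis unfolding f_def by auto
  qed
  have f_lim: "(\<lambda>n. f n z) \<longlonglongrightarrow> indicator A z" for z
  proof (cases "z \<in> A")
    case True
    obtain N where N: "2 < real N * g z"
      using reals_Archimedean3[of "g z"] True g_pos by blast
    have "f n z = 1" if "n \<ge> N" for n
    proof -
      have "real N * g z \<le> real n * g z"
        using that g0[of z] by (intro mult_right_mono) auto
      with N show ?thesis by (simp add: f_def)
    qed
    then have "eventually (\<lambda>n. f n z = indicator A z) sequentially"
      using True by (auto simp: eventually_sequentially)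
    then show ?thesis by (rule tendsto_eventually)
  next
    case False
    then have "g z = 0" using g_pos[of z] g0[of z] by simp
    with False show ?thesis by (simp add: f_def)
  qed
  have int_eq: "(\<integral>\<^sup>+z. ennreal (f n z) \<partial>\<nu>) = (\<integral>\<^sup>+z. ennreal (f n z * herglotz_re \<alpha> \<beta> z) \<partial>circle_haar)" for n
  proof -
    \<comment> \<open>If |z - 1| |z + 1| is below the square of 1 / (n + 1), one factor is below 1 /
      (n + 1), and so is the distance from z to the complement of A, which contains 1 and
      -1.\<close>
    define \<delta> where "\<delta> = min 1 ((1 / (real n + 1))\<^sup>2)"
    have "f n z = 0" if "cmod (z\<^sup>2 - 1) < \<delta>" for z
    proof -
      have "cmod (z - 1) * cmod (z + 1) = cmod (z\<^sup>2 - 1)"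
        by (simp add: power2_eq_square algebra_simps flip: norm_mult)
      also have "\<dots> < (1 / (real n + 1))\<^sup>2"
        using that by (simp add: \<delta>_def)
      finally have "cmod (z - 1) < 1 / (real n + 1) \<or> cmod (z + 1) < 1 / (real n + 1)"
        using mult_mono[of "1 / (real n + 1)" "cmod (z - 1)" "1 / (real n + 1)" "cmod (z + 1)"]
        by (force simp: power2_eq_square not_less)
      then have "g z < 1 / (real n + 1)"
        using infdist_le[of 1 "- A" z] infdist_le[of "- 1" "- A" z] O(2,3)
        by (auto simp: g_def dist_norm)
      then have "real n * g z \<le> real n * (1 / (real n + 1))"
        by (intro mult_left_mono) auto
      also have "\<dots> \<le> 1" by (simp add: field_simps)
      finally show ?thesis by (simp add: f_def)
    qed
    moreover have "0 < \<delta>" by (simp add: \<delta>_def)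
    ultimately have *: "integrable circle_haar (\<lambda>z. f n z * herglotz_re \<alpha> \<beta> z)"
      "(\<integral>z. f n z \<partial>\<nu>) = (\<integral>z. f n z * herglotz_re \<alpha> \<beta> z \<partial>circle_haar)"
      using integral_away_from_atoms[OF cont] by blast+
    have "(\<integral>\<^sup>+z. ennreal (f n z) \<partial>\<nu>) = ennreal (\<integral>z. f n z \<partial>\<nu>)"
      by (intro nn_integral_eq_integral integrable_continuous cont) (simp add: f01)
    also have "\<dots> = (\<integral>\<^sup>+z. ennreal (f n z * herglotz_re \<alpha> \<beta> z) \<partial>circle_haar)"
      unfolding *(2) by (intro nn_integral_eq_integral[symmetric] *(1)) (simp add: f01 herglotz_re_nonneg)
    finally show ?thesis .
  qed
  have "(\<lambda>n. \<integral>\<^sup>+z. ennreal (f n z) \<partial>\<nu>) \<longlonglongrightarrow> (\<integral>\<^sup>+z. ennreal (indicator A z) \<partial>\<nu>)"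
    by (intro nn_integral_LIMSEQ tendsto_ennrealI f_lim)
      (auto simp: incseq_def le_fun_def intro!: ennreal_leI f_mono)
  moreover have "(\<lambda>n. \<integral>\<^sup>+z. ennreal (f n z * herglotz_re \<alpha> \<beta> z) \<partial>circle_haar)
      \<longlonglongrightarrow> (\<integral>\<^sup>+z. ennreal (indicator A z * herglotz_re \<alpha> \<beta> z) \<partial>circle_haar)"
    by (intro nn_integral_LIMSEQ tendsto_ennrealI tendsto_mult f_lim tendsto_const)
      (auto simp: incseq_def le_fun_def intro!: ennreal_leI mult_right_mono f_mono herglotz_re_nonneg)
  ultimately have "(\<integral>\<^sup>+z. ennreal (indicator A z) \<partial>\<nu>)
      = (\<integral>\<^sup>+z. ennreal (indicator A z * herglotz_re \<alpha> \<beta> z) \<partial>circle_haar)"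
    unfolding int_eq by (rule LIMSEQ_unique)
  moreover have "(\<integral>\<^sup>+z. ennreal (indicator A z) \<partial>\<nu>) = emeasure \<nu> A"
    using O(1) by (simp add: ennreal_indicator)
  moreover have "ennreal (indicator A z * herglotz_re \<alpha> \<beta> z) = ennreal (herglotz_re \<alpha> \<beta> z) * indicator A z" for z
    by (auto simp: indicator_def)
  ultimately show ?thesis by simp
qed

end

section \<open>The law on the circle\<close>

text \<open>On the circle H^2 is real: (\<alpha> + \<beta> z) (\<beta> + \<alpha> z) = z |\<alpha> +
  \<beta> z|^2 and (1 - z^2)^2 = - 4 z^2 (sin \<theta>)^2, so the powers of z cancel. A negative
  value makes H imaginary, which is why the density vanishes there.\<close>

lemma herglotz_re_cis:
  fixes \<alpha> \<beta> \<theta> :: real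
  defines "N \<equiv> (sin \<theta>)\<^sup>2 - (2 * \<alpha> * \<beta> * cos \<theta> + \<alpha>\<^sup>2 + \<beta>\<^sup>2)"
  assumes "sin \<theta> \<noteq> 0"
  shows "herglotz_re \<alpha> \<beta> (cis \<theta>) = (if 0 < N then sqrt N / \<bar>sin \<theta>\<bar> else 0)"
proof -
  define z where "z = cis \<theta>"
  have z: "z \<noteq> 0" "z * cnj z = 1"
    by (simp_all add: z_def cis_cnj cis_mult)
  have zz: "z + cnj z = of_real (2 * cos \<theta>)" "cnj z - z = - 2 * \<i> * of_real (sin \<theta>)"
    by (simp_all add: z_def complex_eq_iff)
  have "(complex_of_real \<alpha> + \<beta> * z) * (complex_of_real \<beta> + \<alpha> * z)
      = z * (of_real \<alpha> * of_real \<beta> * (z + cnj z) + (of_real \<alpha>)\<^sup>2 + (of_real \<beta>)\<^sup>2)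
        + of_real \<alpha> * of_real \<beta> * (1 - z * cnj z)"
    by (simp add: power2_eq_square algebra_simps)
  then have num: "(complex_of_real \<alpha> + \<beta> * z) * (complex_of_real \<beta> + \<alpha> * z)
      = z * of_real (2 * \<alpha> * \<beta> * cos \<theta> + \<alpha>\<^sup>2 + \<beta>\<^sup>2)"
    by (simp add: z zz)
  have "1 - z\<^sup>2 = z * (cnj z - z)"
    by (simp add: right_diff_distrib z power2_eq_square)
  then have den: "(1 - z\<^sup>2)\<^sup>2 = - 4 * z\<^sup>2 * of_real ((sin \<theta>)\<^sup>2)"
    unfolding zz by (simp add: power_mult_distrib)
  have "herglotz_square \<alpha> \<beta> z = 1 + 4 * z * (z * of_real (2 * \<alpha> * \<beta> * cos \<theta> + \<alpha>\<^sup>2 + \<beta>\<^sup>2))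
      / (- 4 * z\<^sup>2 * of_real ((sin \<theta>)\<^sup>2))"
    unfolding herglotz_square_def den mult.assoc[of "4 * z"] num ..
  also have "\<dots> = 1 - of_real (2 * \<alpha> * \<beta> * cos \<theta> + \<alpha>\<^sup>2 + \<beta>\<^sup>2) / of_real ((sin \<theta>)\<^sup>2)"
    using z(1) by (simp add: power2_eq_square)
  also have "\<dots> = of_real (1 - (2 * \<alpha> * \<beta> * cos \<theta> + \<alpha>\<^sup>2 + \<beta>\<^sup>2) / (sin \<theta>)\<^sup>2)"
    by (simp only: of_real_1 of_real_diff of_real_divide)
  also have "1 - (2 * \<alpha> * \<beta> * cos \<theta> + \<alpha>\<^sup>2 + \<beta>\<^sup>2) / (sin \<theta>)\<^sup>2 = N / (sin \<theta>)\<^sup>2"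
    using assms(2) by (simp add: N_def diff_divide_distrib)
  finally have "herglotz_re \<alpha> \<beta> z = sqrt ((\<bar>N / (sin \<theta>)\<^sup>2\<bar> + N / (sin \<theta>)\<^sup>2) / 2)"
    by (simp only: herglotz_re_def norm_of_real complex.sel Re_complex_of_real)
  also have "\<dots> = (if 0 < N then sqrt N / \<bar>sin \<theta>\<bar> else 0)"
  proof (cases "0 < N")
    case True
    then have "0 < N / (sin \<theta>)\<^sup>2"
      using assms(2) by simp
    with True show ?thesis by (simp add: real_sqrt_divide)
  next
    case False
    then have "N / (sin \<theta>)\<^sup>2 \<le> 0"
      by (intro divide_nonpos_nonneg) auto
    with False show ?thesis by simp
  qed
  finally show ?thesis by (simp add: z_def)
qed

context free_symmetries_law
begin

theorem law_eq:
  fixes r_plus r_minus :: real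
  assumes \<alpha>: "\<bar>\<alpha>\<bar> \<le> 1" and \<beta>: "\<bar>\<beta>\<bar> \<le> 1"
  defines "r_plus \<equiv> - \<alpha> * \<beta> + sqrt ((1 - \<alpha>\<^sup>2) * (1 - \<beta>\<^sup>2))"
    and "r_minus \<equiv> - \<alpha> * \<beta> - sqrt ((1 - \<alpha>\<^sup>2) * (1 - \<beta>\<^sup>2))"
  shows "\<nu> = distr
    (add_measure
      (add_measure (scale_measure (ennreal (\<bar>\<alpha> - \<beta>\<bar> / 2)) (return borel pi))
                   (scale_measure (ennreal (\<bar>\<alpha> + \<beta>\<bar> / 2)) (return borel 0)))
      (density lborel (\<lambda>\<theta>. ennreal
        (sqrt (- (cos \<theta> - r_plus) * (cos \<theta> - r_minus)) / (2 * pi * \<bar>sin \<theta>\<bar>)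
          * indicator ({arccos r_plus<..<arccos r_minus} \<union> {- arccos r_minus<..<- arccos r_plus}) \<theta>))))
    borel cis"
    (is "_ = distr (add_measure (add_measure ?A ?B) (density lborel (\<lambda>\<theta>. ennreal (?d \<theta>)))) borel cis")
proof -
  define N where "N \<theta> = (sin \<theta>)\<^sup>2 - (2 * \<alpha> * \<beta> * cos \<theta> + \<alpha>\<^sup>2 + \<beta>\<^sup>2)" for \<theta>
  define s where "s = sqrt ((1 - \<alpha>\<^sup>2) * (1 - \<beta>\<^sup>2))"
  have le1: "\<alpha>\<^sup>2 \<le> 1" "\<beta>\<^sup>2 \<le> 1"
    using \<alpha> \<beta> by (simp_all add: abs_square_le_1)
  then have s: "0 \<le> s" "s\<^sup>2 = (1 - \<alpha>\<^sup>2) * (1 - \<beta>\<^sup>2)"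
    by (simp_all add: s_def)
  have \<alpha>\<beta>: "\<bar>\<alpha> * \<beta>\<bar> \<le> 1"
    using mult_mono[OF \<alpha> \<beta>] by (simp add: abs_mult)
  \<comment> \<open>s^2 falls short of (1 + \<alpha> \<beta>)^2 by (\<alpha> + \<beta>)^2, and of (1
    - \<alpha> \<beta>)^2 by (\<alpha> - \<beta>)^2. This places both radii in [-1, 1], where
    \<open>arccos\<close> inverts \<open>cos\<close>.\<close>
  have "s \<le> 1 + \<alpha> * \<beta>"
  proof (rule power2_le_imp_le)
    have "(1 + \<alpha> * \<beta>)\<^sup>2 - s\<^sup>2 = (\<alpha> + \<beta>)\<^sup>2"
      unfolding s(2) by (simp add: power2_eq_square algebra_simps)
    then show "s\<^sup>2 \<le> (1 + \<alpha> * \<beta>)\<^sup>2"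
      using zero_le_power2[of "\<alpha> + \<beta>"] by linarith
  qed (use \<alpha>\<beta> in linarith)
  moreover have "s \<le> 1 - \<alpha> * \<beta>"
  proof (rule power2_le_imp_le)
    have "(1 - \<alpha> * \<beta>)\<^sup>2 - s\<^sup>2 = (\<alpha> - \<beta>)\<^sup>2"
      unfolding s(2) by (simp add: power2_eq_square algebra_simps)
    then show "s\<^sup>2 \<le> (1 - \<alpha> * \<beta>)\<^sup>2"
      using zero_le_power2[of "\<alpha> - \<beta>"] by linarith
  qed (use \<alpha>\<beta> in linarith)
  moreover have r_def: "r_plus = - \<alpha> * \<beta> + s" "r_minus = - \<alpha> * \<beta> - s"
    by (simp_all add: r_plus_def r_minus_def s_def)
  ultimately have r: "- 1 \<le> r_minus" "r_minus \<le> r_plus" "r_plus \<le> 1"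
    using s(1) by auto
  \<comment> \<open>Completing the square in the variable cos \<theta> turns N into s^2 - (cos
    \<theta> + \<alpha> \<beta>)^2; \<open>r_plus\<close> and \<open>r_minus\<close> are its
    roots.\<close>
  have N: "- (cos \<theta> - r_plus) * (cos \<theta> - r_minus) = N \<theta>" for \<theta>
  proof -
    have "- (cos \<theta> - r_plus) * (cos \<theta> - r_minus) = s\<^sup>2 - (cos \<theta> + \<alpha> * \<beta>)\<^sup>2"
      unfolding r_def by (simp add: power2_eq_square algebra_simps)
    also have "\<dots> = N \<theta>"
      unfolding s(2) N_def sin_squared_eq by (simp add: power2_eq_square algebra_simps)
    finally show ?thesis .
  qed
  have N_pos: "0 < N \<theta> \<longleftrightarrow> r_minus < cos \<theta> \<and> cos \<theta> < r_plus" for \<theta>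
    using r(2) by (auto simp: zero_less_mult_iff mult_less_0_iff simp flip: N)
  have supp: "\<theta> \<in> {arccos r_plus<..<arccos r_minus} \<union> {- arccos r_minus<..<- arccos r_plus}
      \<longleftrightarrow> 0 < N \<theta>" (is "\<theta> \<in> ?S \<longleftrightarrow> _") if "- pi < \<theta>" "\<theta> < pi" "\<theta> \<noteq> 0" for \<theta>
  proof -
    have "\<bar>\<theta>\<bar> = arccos (cos \<theta>)"
      using that by (simp add: arccos_cos_eq_abs)
    then have *: "arccos r_plus < \<bar>\<theta>\<bar> \<longleftrightarrow> cos \<theta> < r_plus" "\<bar>\<theta>\<bar> < arccos r_minus \<longleftrightarrow> r_minus < cos \<theta>"
      using r by (simp_all add: arccos_less_mono)
    have "\<theta> \<in> ?S \<longleftrightarrow> arccos r_plus < \<bar>\<theta>\<bar> \<and> \<bar>\<theta>\<bar> < arccos r_minus"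
      using arccos_lbound[of r_plus] r by auto
    then show ?thesis
      unfolding * N_pos by auto
  qed
  have outside: "\<theta> \<notin> {arccos r_plus<..<arccos r_minus} \<union> {- arccos r_minus<..<- arccos r_plus}"
    if "\<theta> \<le> - pi \<or> pi \<le> \<theta>" for \<theta>
    using that arccos_lbound[of r_plus] arccos_ubound[of r_minus] arccos_ubound[of r_plus]
      arccos_lbound[of r_minus] r by auto
  \<comment> \<open>The excluded angles are mapped to 1 and -1, where sin \<theta> = 0, and form a
    null set. Beyond [-pi, pi] both sides are 0, because \<open>arccos\<close> takes values in
    [0, pi].\<close>
  have density_eq: "ennreal (?d \<theta>) = ennreal (indicator {-pi..pi} \<theta> / (2 * pi)) * ennreal (herglotz_re \<alpha> \<beta> (cis \<theta>))"
    if "\<theta> \<notin> {- pi, 0, pi}" for \<theta>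
  proof (cases "- pi < \<theta> \<and> \<theta> < pi")
    case True
    then have "sin \<theta> \<noteq> 0"
      using that sin_gt_zero[of \<theta>] sin_gt_zero[of "- \<theta>"] by (cases "0 < \<theta>") auto
    then have h: "herglotz_re \<alpha> \<beta> (cis \<theta>) = (if 0 < N \<theta> then sqrt (N \<theta>) / \<bar>sin \<theta>\<bar> else 0)"
      unfolding N_def by (rule herglotz_re_cis)
    have "?d \<theta> = indicator {-pi..pi} \<theta> / (2 * pi) * herglotz_re \<alpha> \<beta> (cis \<theta>)"
      unfolding N h using True that supp[of \<theta>] by (simp add: indicator_def)
    then have "ennreal (?d \<theta>) = ennreal (indicator {-pi..pi} \<theta> / (2 * pi) * herglotz_re \<alpha> \<beta> (cis \<theta>))"
      by (rule arg_cong)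
    also have "\<dots> = ennreal (indicator {-pi..pi} \<theta> / (2 * pi)) * ennreal (herglotz_re \<alpha> \<beta> (cis \<theta>))"
      by (rule ennreal_mult) (simp_all add: herglotz_re_nonneg)
    finally show ?thesis .
  next
    case False
    with that outside[of \<theta>] show ?thesis
      by (auto simp: indicator_def)
  qed
  define \<mu> where "\<mu> = distr (add_measure (add_measure ?A ?B) (density lborel (\<lambda>\<theta>. ennreal (?d \<theta>)))) borel cis"
  have \<mu>: "emeasure \<mu> A = ennreal (\<bar>\<alpha> - \<beta>\<bar> / 2) * indicator A (- 1) + ennreal (\<bar>\<alpha> + \<beta>\<bar> / 2) * indicator A 1
      + (\<integral>\<^sup>+z. ennreal (herglotz_re \<alpha> \<beta> z) * indicator A z \<partial>circle_haar)" if A: "A \<in> sets borel" for A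
  proof -
    have pre: "cis -` A \<in> sets borel"
      using measurable_sets[OF measurable_cis A] by simp
    have [measurable]: "(\<lambda>\<theta>. ?d \<theta>) \<in> borel_measurable borel"
      by measurable
    let ?M = "add_measure (add_measure ?A ?B) (density lborel (\<lambda>\<theta>. ennreal (?d \<theta>)))"
    have sets: "sets ?M = sets borel"
      by simp
    have space: "space ?M = UNIV"
      by (simp only: sets_eq_imp_space_eq[OF sets] space_borel)
    have cis: "cis \<in> measurable ?M borel"
      unfolding measurable_cong_sets[OF sets refl] by (rule measurable_cis)
    have "emeasure \<mu> A = emeasure ?M (cis -` A)"
      unfolding \<mu>_def emeasure_distr[OF cis A] space Int_UNIV_right ..
    also have "\<dots> = emeasure ?A (cis -` A) + emeasure ?B (cis -` A)
        + emeasure (density lborel (\<lambda>\<theta>. ennreal (?d \<theta>))) (cis -` A)"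
      by (simp add: emeasure_add_measure)
    also have "emeasure ?A (cis -` A) = ennreal (\<bar>\<alpha> - \<beta>\<bar> / 2) * indicator A (- 1)"
      using pre by (simp add: emeasure_return indicator_def)
    also have "emeasure ?B (cis -` A) = ennreal (\<bar>\<alpha> + \<beta>\<bar> / 2) * indicator A 1"
      using pre by (simp add: emeasure_return indicator_def)
    also have "emeasure (density lborel (\<lambda>\<theta>. ennreal (?d \<theta>))) (cis -` A)
        = (\<integral>\<^sup>+\<theta>. ennreal (?d \<theta>) * indicator (cis -` A) \<theta> \<partial>lborel)"
      using pre by (subst emeasure_density) auto
    also have "\<dots> = (\<integral>\<^sup>+\<theta>. ennreal (indicator {-pi..pi} \<theta> / (2 * pi))
        * (ennreal (herglotz_re \<alpha> \<beta> (cis \<theta>)) * indicator A (cis \<theta>)) \<partial>lborel)"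
    proof (rule nn_integral_cong_AE)
      have "AE \<theta> in lborel. \<theta> \<notin> {- pi, 0, pi}"
        by (intro AE_not_in finite_imp_null_set_lborel) simp
      then show "AE \<theta> in lborel. ennreal (?d \<theta>) * indicator (cis -` A) \<theta> = ennreal (indicator {-pi..pi} \<theta> / (2 * pi))
          * (ennreal (herglotz_re \<alpha> \<beta> (cis \<theta>)) * indicator A (cis \<theta>))"
      proof eventually_elim
        case (elim \<theta>)
        have "(indicator (cis -` A) \<theta> :: ennreal) = indicator A (cis \<theta>)"
          by (simp add: indicator_def)
        then show ?case
          unfolding density_eq[OF elim] by (simp only: mult.assoc)
      qed
    qed
    also have "\<dots> = (\<integral>\<^sup>+z. ennreal (herglotz_re \<alpha> \<beta> z) * indicator A z \<partial>circle_haar)"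
      using A by (subst nn_integral_circle_haar) auto
    finally show ?thesis .
  qed
  have AE_pm1: "AE z in circle_haar. z \<notin> {1, - 1}"
  proof -
    have "emeasure circle_haar {1, - 1} = (\<integral>\<^sup>+z. indicator {1, - 1} z \<partial>circle_haar)"
      by simp
    also have "\<dots> = (\<integral>\<^sup>+\<theta>. ennreal (indicator {- pi..pi} \<theta> / (2 * pi)) * indicator {1, - 1} (cis \<theta>) \<partial>lborel)"
      by (rule nn_integral_circle_haar) simp
    also have "\<dots> = (\<integral>\<^sup>+\<theta>. 0 \<partial>(lborel :: real measure))"
    proof (rule nn_integral_cong_AE)
      have "AE \<theta> in lborel. \<theta> \<notin> {- pi, 0, pi}"
        by (intro AE_not_in finite_imp_null_set_lborel) simp
      then show "AE \<theta> in lborel. ennreal (indicator {- pi..pi} \<theta> / (2 * pi)) * indicator {1, - 1} (cis \<theta>) = 0"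
      proof eventually_elim
        case (elim \<theta>)
        show ?case
        proof (cases "- pi < \<theta> \<and> \<theta> < pi")
          case True
          then have "sin \<theta> \<noteq> 0"
            using elim sin_gt_zero[of \<theta>] sin_gt_zero[of "- \<theta>"] by (cases "0 < \<theta>") auto
          then show ?thesis by (auto simp: indicator_def complex_eq_iff)
        next
          case False
          with elim show ?thesis by (auto simp: indicator_def)
        qed
      qed
    qed
    finally have "{1, - 1} \<in> null_sets circle_haar"
      by (intro null_setsI) simp_all
    then show ?thesis by (rule AE_not_in)
  qed
  \<comment> \<open>Open sets are an intersection-stable generator, and an open set stays open
    without 1 and -1. Haar measure does not charge these points, so the density may be integrated
    over all of A.\<close>
  have eq: "emeasure \<nu> A = emeasure \<mu> A" if A: "open A" for A
  proof -
    define A' where "A' = A - {1, - 1}"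
    have [measurable]: "A \<in> sets borel" "A' \<in> sets borel" using A by (auto simp: A'_def)
    have atoms: "emeasure \<nu> {- 1} = ennreal (\<bar>\<alpha> - \<beta>\<bar> / 2)" "emeasure \<nu> {1} = ennreal (\<bar>\<alpha> + \<beta>\<bar> / 2)"
      using measure_atom[of "- 1"] measure_atom[of 1] by (simp_all add: emeasure_eq_measure)
    have "A = A' \<union> (A \<inter> {- 1}) \<union> (A \<inter> {1})"
      by (auto simp: A'_def)
    then have "emeasure \<nu> A = emeasure \<nu> (A' \<union> (A \<inter> {- 1}) \<union> (A \<inter> {1}))"
      by simp
    also have "\<dots> = emeasure \<nu> (A' \<union> (A \<inter> {- 1})) + emeasure \<nu> (A \<inter> {1})"
      by (intro plus_emeasure[symmetric]) (auto simp: A'_def)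
    also have "emeasure \<nu> (A' \<union> (A \<inter> {- 1})) = emeasure \<nu> A' + emeasure \<nu> (A \<inter> {- 1})"
      by (intro plus_emeasure[symmetric]) (auto simp: A'_def)
    also have "emeasure \<nu> (A \<inter> {1}) = ennreal (\<bar>\<alpha> + \<beta>\<bar> / 2) * indicator A 1"
      by (cases "1 \<in> A") (simp_all add: atoms)
    also have "emeasure \<nu> (A \<inter> {- 1}) = ennreal (\<bar>\<alpha> - \<beta>\<bar> / 2) * indicator A (- 1)"
      by (cases "- 1 \<in> A") (simp_all add: atoms)
    also have "emeasure \<nu> A' = (\<integral>\<^sup>+z. ennreal (herglotz_re \<alpha> \<beta> z) * indicator A' z \<partial>circle_haar)"
      using A by (intro emeasure_open_away_from_atoms) (auto simp: A'_def intro!: open_Diff)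
    also have "\<dots> = (\<integral>\<^sup>+z. ennreal (herglotz_re \<alpha> \<beta> z) * indicator A z \<partial>circle_haar)"
    proof (rule nn_integral_cong_AE)
      show "AE z in circle_haar. ennreal (herglotz_re \<alpha> \<beta> z) * indicator A' z
          = ennreal (herglotz_re \<alpha> \<beta> z) * indicator A z"
        using AE_pm1 by eventually_elim (auto simp: A'_def indicator_def)
    qed
    finally show ?thesis
      by (simp add: \<mu> ac_simps)
  qed
  have "\<nu> = \<mu>"
  proof (rule measure_eqI_generator_eq[where E = "Collect open" and \<Omega> = UNIV and A = "\<lambda>_. UNIV"])
    show "sets \<nu> = sigma_sets UNIV (Collect open)" "sets \<mu> = sigma_sets UNIV (Collect open)"
      by (simp_all add: \<mu>_def borel_def)
    show "emeasure \<nu> UNIV \<noteq> \<infinity>"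
      by simp
  qed (auto simp: Int_stable_def intro: eq)
  then show ?thesis
    by (simp add: \<mu>_def)
qed

end

section \<open>Spectral distributions of unitaries\<close>

context wstar_probability_space
begin

text \<open>Powers of a unitary are unitary, so the second and fourth absolute moments are 1 and the
  integral of (|z|^2 - 1)^2 is 1 - 2 + 1 = 0.\<close>

lemma spectral_distribution_unitary:
  assumes \<mu>: "spectral_distribution \<tau> x \<mu>" and x: "unitary x"
  shows "circle_measure \<mu>"
proof -
  interpret prob_space \<mu>
    using \<mu> by (simp add: spectral_distribution_def)
  have sets [measurable_cong]: "sets \<mu> = sets borel"
    using \<mu> by (simp add: spectral_distribution_def)
  obtain r where r: "AE z in \<mu>. cmod z \<le> r"
    using \<mu> by (auto simp: spectral_distribution_def)
  have int_real: "integrable \<mu> (\<lambda>z. cmod z ^ k)" for k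
  proof (rule integrable_const_bound)
    show "AE z in \<mu>. norm (cmod z ^ k) \<le> \<bar>r\<bar> ^ k"
      using r by eventually_elim (auto intro!: power_mono)
  qed measurable
  then have int: "integrable \<mu> (\<lambda>z. complex_of_real (cmod z ^ k))" for k
    by (rule integrable_of_real)
  have moment: "(\<integral>z. complex_of_real (cmod z ^ (2 * n)) \<partial>\<mu>) = 1" for n
  proof -
    have "(\<integral>z. complex_of_real (cmod z ^ (2 * n)) \<partial>\<mu>) = (\<integral>z. z ^ n * cnj z ^ n \<partial>\<mu>)"
      by (intro Bochner_Integration.integral_cong refl, subst power_mult, subst of_real_power,
          subst complex_norm_square, rule power_mult_distrib)
    also have "\<dots> = \<tau> (x ^ n * star x ^ n)"
      using \<mu> by (simp add: spectral_distribution_def)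
    also have "x ^ n * star x ^ n = 1"
      using unitary_power[OF x, of n] by (simp add: unitary_def star_power)
    finally show ?thesis by simp
  qed
  have "complex_of_real ((cmod z ^ 2 - 1) ^ 2)
      = complex_of_real (cmod z ^ (2 * 2)) - 2 * complex_of_real (cmod z ^ (2 * 1)) + 1" for z
    by (simp add: power2_eq_square power4_eq_xxxx algebra_simps)
  then have "(\<integral>z. complex_of_real ((cmod z ^ 2 - 1) ^ 2) \<partial>\<mu>)
      = (\<integral>z. complex_of_real (cmod z ^ (2 * 2)) - 2 * complex_of_real (cmod z ^ (2 * 1)) + 1 \<partial>\<mu>)"
    by (simp only:)
  also have "\<dots> = (\<integral>z. complex_of_real (cmod z ^ (2 * 2)) \<partial>\<mu>)
      - 2 * (\<integral>z. complex_of_real (cmod z ^ (2 * 1)) \<partial>\<mu>) + (\<integral>z. 1 \<partial>\<mu>)"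
    by (simp only: Bochner_Integration.integral_add Bochner_Integration.integral_diff
        integrable_mult_right Bochner_Integration.integrable_diff integrable_const int
        integral_mult_right_zero)
  also have "\<dots> = 0"
    unfolding moment by (simp add: prob_space)
  finally have "(\<integral>z. (cmod z ^ 2 - 1) ^ 2 \<partial>\<mu>) = 0"
    by (simp only: integral_complex_of_real of_real_eq_0_iff)
  moreover have "integrable \<mu> (\<lambda>z. (cmod z ^ 2 - 1) ^ 2)"
  proof -
    have "integrable \<mu> (\<lambda>z. cmod z ^ 4 - 2 * cmod z ^ 2 + 1)"
      using int_real by simp
    then show ?thesis
      by (simp add: power2_eq_square power4_eq_xxxx algebra_simps)
  qed
  ultimately have "AE z in \<mu>. (cmod z ^ 2 - 1) ^ 2 = 0"
    by (subst (asm) integral_nonneg_eq_0_iff_AE) auto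
  then have "AE z in \<mu>. cmod z = 1"
  proof eventually_elim
    case (elim z)
    then show ?case
      using norm_ge_zero[of z] by (auto simp: power2_eq_1_iff simp del: norm_ge_zero)
  qed
  then show ?thesis
    by unfold_locales (simp_all add: sets)
qed

lemma spectral_distribution_moment:
  assumes "spectral_distribution \<tau> x \<mu>"
  shows "(\<integral>z. z ^ n \<partial>\<mu>) = \<tau> (x ^ n)"
proof -
  have "\<tau> (x ^ n * star x ^ 0) = (\<integral>z. z ^ n * cnj z ^ 0 \<partial>\<mu>)"
    using assms unfolding spectral_distribution_def by blast
  then show ?thesis by simp
qed

end

text \<open>Weak convergence is tested on bounded continuous functions of the plane, so both claims
  need test functions adapted to the circle.\<close>

lemma weak_limit_circle_measure:
  assumes weak: "weakly_converges M N G" and G: "G \<noteq> bot"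
    and M: "eventually (\<lambda>t. circle_measure (M t)) G"
    and N: "prob_space N" "sets N = sets borel"
  shows "circle_measure N" and "((\<lambda>t. \<integral>z. z ^ n \<partial>M t) \<longlongrightarrow> (\<integral>z. z ^ n \<partial>N)) G"
proof -
  interpret N: prob_space N by fact
  note N(2) [measurable_cong]
  have lim: "((\<lambda>t. \<integral>z. f z \<partial>M t) \<longlongrightarrow> (\<integral>z. f z \<partial>N)) G"
    if "continuous_on UNIV f" "\<And>z. \<bar>f z\<bar> \<le> 1" for f :: "complex \<Rightarrow> real"
    using weak that unfolding weakly_converges_def by (auto simp: bounded_iff)
  have cong: "(\<integral>z. f z \<partial>K) = (\<integral>z. g z \<partial>K)"
    if K: "circle_measure K" and fg: "\<And>z. cmod z = 1 \<Longrightarrow> f z = g z"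
      and [measurable]: "f \<in> borel_measurable borel" "g \<in> borel_measurable borel"
    for f g :: "complex \<Rightarrow> real" and K
  proof -
    interpret K: circle_measure K by fact
    show ?thesis
      using K.AE_circle fg by (intro integral_cong_AE) (auto elim!: eventually_mono)
  qed
  \<comment> \<open>Bounded, continuous and zero exactly on the circle: its integral against the
    limit must vanish.\<close>
  define d where "d z = min 1 \<bar>cmod z - 1\<bar>" for z :: complex
  have cont_d: "continuous_on UNIV d"
    unfolding d_def by (intro continuous_intros)
  note [measurable] = borel_measurable_continuous_onI[OF cont_d]
  have "eventually (\<lambda>t. (\<integral>z. d z \<partial>M t) = 0) G"
    using M
  proof eventually_elim
    case (elim t)
    have "(\<integral>z. d z \<partial>M t) = (\<integral>z. 0 \<partial>M t)"
      by (rule cong[OF elim]) (simp_all add: d_def)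
    then show ?case by simp
  qed
  then have "((\<lambda>t. \<integral>z. d z \<partial>M t) \<longlongrightarrow> 0) G"
    by (rule tendsto_eventually)
  moreover have "((\<lambda>t. \<integral>z. d z \<partial>M t) \<longlongrightarrow> (\<integral>z. d z \<partial>N)) G"
    by (rule lim[OF cont_d]) (simp add: d_def)
  ultimately have "(\<integral>z. d z \<partial>N) = 0"
    using tendsto_unique[OF G] by blast
  moreover have "integrable N d"
    by (rule N.integrable_const_bound[of _ 1]) (simp_all add: d_def)
  ultimately have "AE z in N. d z = 0"
    by (subst (asm) integral_nonneg_eq_0_iff_AE) (simp_all add: d_def)
  then have "AE z in N. cmod z = 1"
    by eventually_elim (simp add: d_def min_def split: if_splits)
  with N show circN: "circle_measure N"
    by (intro circle_measure.intro circle_measure_axioms.intro)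
  have part: "((\<lambda>t. \<integral>z. p (z ^ n) \<partial>M t) \<longlongrightarrow> (\<integral>z. p (z ^ n) \<partial>N)) G"
    if p: "p = Re \<or> p = Im" for p
  proof -
    \<comment> \<open>z^n is unbounded on the plane; clipping its real and imaginary parts to
      [-1, 1] changes nothing on the circle.\<close>
    define f where "f z = max (- 1) (min 1 (p (z ^ n)))" for z :: complex
    have cont: "continuous_on UNIV (\<lambda>z. p (z ^ n))"
      using p by (auto intro!: continuous_intros)
    then have cont_f: "continuous_on UNIV f"
      unfolding f_def by (intro continuous_intros)
    note meas = borel_measurable_continuous_onI[OF cont] borel_measurable_continuous_onI[OF cont_f]
    have eq: "f z = p (z ^ n)" if "cmod z = 1" for z
    proof -
      have "\<bar>p (z ^ n)\<bar> \<le> 1"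
        using p abs_Re_le_cmod[of "z ^ n"] abs_Im_le_cmod[of "z ^ n"] that by (auto simp: norm_power)
      then show ?thesis by (auto simp: f_def)
    qed
    have "((\<lambda>t. \<integral>z. f z \<partial>M t) \<longlongrightarrow> (\<integral>z. f z \<partial>N)) G"
      by (rule lim[OF cont_f]) (auto simp: f_def)
    then have "((\<lambda>t. \<integral>z. f z \<partial>M t) \<longlongrightarrow> (\<integral>z. p (z ^ n) \<partial>N)) G"
      by (simp only: cong[OF circN eq meas(2,1)])
    moreover have "eventually (\<lambda>t. (\<integral>z. f z \<partial>M t) = (\<integral>z. p (z ^ n) \<partial>M t)) G"
      using M by eventually_elim (rule cong[OF _ eq meas(2,1)])
    ultimately show ?thesis
      using tendsto_cong by fast
  qed
  have eq: "(\<integral>z. z ^ n \<partial>K) = of_real (\<integral>z. Re (z ^ n) \<partial>K) + \<i> * of_real (\<integral>z. Im (z ^ n) \<partial>K)"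
    if "circle_measure K" for K
  proof -
    interpret K: circle_measure K by fact
    have "integrable K (\<lambda>z. z ^ n)"
      by (rule K.integrable_circle[of _ 1]) (auto simp: norm_power)
    then show ?thesis
      by (simp add: complex_eq_iff integral_Re integral_Im)
  qed
  have "((\<lambda>t. complex_of_real (\<integral>z. Re (z ^ n) \<partial>M t) + \<i> * of_real (\<integral>z. Im (z ^ n) \<partial>M t))
      \<longlongrightarrow> of_real (\<integral>z. Re (z ^ n) \<partial>N) + \<i> * of_real (\<integral>z. Im (z ^ n) \<partial>N)) G"
    by (intro tendsto_intros part) auto
  moreover have "eventually (\<lambda>t. complex_of_real (\<integral>z. Re (z ^ n) \<partial>M t) + \<i> * of_real (\<integral>z. Im (z ^ n) \<partial>M t)
      = (\<integral>z. z ^ n \<partial>M t)) G"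
    using M by eventually_elim (rule eq[symmetric])
  ultimately show "((\<lambda>t. \<integral>z. z ^ n \<partial>M t) \<longlongrightarrow> (\<integral>z. z ^ n \<partial>N)) G"
    unfolding eq[OF circN] using tendsto_cong by fast
qed

theorem proposition2p6:
  fixes \<tau> :: "'a::cstar_algebra \<Rightarrow> complex"
    and R S :: 'a and U :: "real \<Rightarrow> 'a"
    and \<alpha> \<beta> a b r_plus r_minus \<theta>_plus \<theta>_minus :: real
    and \<nu> :: "real \<Rightarrow> complex measure" and \<nu>_inf :: "complex measure"
  assumes "wstar_probability_space \<tau>"
    and "symmetry R" and "symmetry S"
    and "\<tau> R = complex_of_real \<alpha>" and "\<tau> S = complex_of_real \<beta>"
    and "free_unitary_brownian_motion \<tau> U"
    and "freely_independent \<tau> (U ` {0..}) {R, S}"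
    and "\<forall>t\<ge>0. spectral_distribution \<tau> (R * U t * S * star (U t)) (\<nu> t)"
    and "prob_space \<nu>_inf" and "sets \<nu>_inf = sets borel"
    and "weakly_converges \<nu> \<nu>_inf at_top"
  defines "a \<equiv> \<bar>\<alpha> - \<beta>\<bar> / 2"
    and "b \<equiv> \<bar>\<alpha> + \<beta>\<bar> / 2"
    and "r_plus \<equiv> - \<alpha> * \<beta> + sqrt ((1 - \<alpha>\<^sup>2) * (1 - \<beta>\<^sup>2))"
    and "r_minus \<equiv> - \<alpha> * \<beta> - sqrt ((1 - \<alpha>\<^sup>2) * (1 - \<beta>\<^sup>2))"
    and "\<theta>_plus \<equiv> arccos r_plus"
    and "\<theta>_minus \<equiv> arccos r_minus"
  shows "\<nu>_inf = distr
    (add_measure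
      (add_measure (scale_measure (ennreal a) (return borel pi))
                   (scale_measure (ennreal b) (return borel 0)))
      (density lborel (\<lambda>\<theta>. ennreal
        (sqrt (- (cos \<theta> - r_plus) * (cos \<theta> - r_minus)) / (2 * pi * \<bar>sin \<theta>\<bar>)
          * indicator ({\<theta>_plus<..<\<theta>_minus} \<union> {- \<theta>_minus<..<- \<theta>_plus}) \<theta>))))
    borel cis"
proof -
  interpret wstar_probability_space \<tau> by fact
  have unitary_RS: "unitary R" "unitary S"
    using assms(2,3) by (simp_all add: symmetry_def)
  have U: "unitary (U t)" if "0 \<le> t" for t
    using assms(6) that by (simp add: free_unitary_brownian_motion_def)
  have "circle_measure (\<nu> t)" if "0 \<le> t" for t
    using assms(8) that
    by (intro spectral_distribution_unitary[of "R * U t * S * star (U t)"] unitary_mult unitary_star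
        unitary_RS U) simp_all
  then have "eventually (\<lambda>t. circle_measure (\<nu> t)) at_top"
    using eventually_ge_at_top[of 0] by (rule eventually_mono[rotated])
  note limit = weak_limit_circle_measure[OF assms(11) trivial_limit_at_top_linorder this assms(9,10)]
  interpret circle_measure \<nu>_inf
    by (rule limit(1))
  \<comment> \<open>Integer times are enough, as the moments of the limit law are limits along any
    sequence of times tending to infinity.\<close>
  have \<tau>_U: "(\<lambda>n. \<tau> (U (real n))) \<longlonglongrightarrow> 0"
  proof (rule tendsto_norm_zero_cancel)
    have "norm (\<tau> (U (real n))) = exp (- 1 / 2) ^ n" for n
      using \<tau>_free_unitary_brownian_motion[OF assms(6), of "real n"]
      by (simp add: norm_exp_eq_Re flip: exp_of_nat_mult)
    then show "(\<lambda>n. norm (\<tau> (U (real n)))) \<longlonglongrightarrow> 0"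
      by (simp add: LIMSEQ_power_zero)
  qed
  have "(\<lambda>n. \<tau> ((R * U (real n) * S * star (U (real n))) ^ k)) \<longlonglongrightarrow> moment k" for k
  proof -
    have "(\<lambda>n. \<integral>z. z ^ k \<partial>\<nu> (real n)) \<longlonglongrightarrow> moment k"
      unfolding moment_def by (rule filterlim_compose[OF limit(2) filterlim_real_sequentially])
    moreover have "(\<integral>z. z ^ k \<partial>\<nu> (real n)) = \<tau> ((R * U (real n) * S * star (U (real n))) ^ k)" for n
      using assms(8) by (intro spectral_distribution_moment) simp
    ultimately show ?thesis by simp
  qed
  note recursion = free_symmetries_moment_recursion[OF assms(2,3) U assms(7) _ \<tau>_U this]
  interpret free_symmetries_law \<nu>_inf \<alpha> \<beta>
    by unfold_locales (rule recursion[unfolded assms(4,5)], simp_all)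
  have "\<bar>\<alpha>\<bar> \<le> 1" "\<bar>\<beta>\<bar> \<le> 1"
    using cmod_\<tau>_unitary[OF unitary_RS(1)] cmod_\<tau>_unitary[OF unitary_RS(2)]
    by (simp_all add: assms(4,5))
  then show ?thesis
    unfolding a_def b_def \<theta>_plus_def \<theta>_minus_def r_plus_def r_minus_def by (rule law_eq)
qed

end
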